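(* Let $T>0$ and $\gamma>0$, and let $\mathcal{F}_T: L^2(\omega_1)\to L^2(\omega)$ be the feedback law defined in the context. Then any solution $y(\cdot)$ to the closed-loop equation $$ \left\{\begin{array}{l} y'(t)-Ay(t)=\mathbf{1}_\omega \sum_{i=0}^{\infty}\chi_{[(2i+1)T,\,(2i+\frac32)T)}(t)\,\mathcal{F}_T\big(\mathbf{1}_{\omega_1}^*y((2i+\tfrac34)T)\big),\quad t>0,\\ y(0)\in L^2(\Omega), \end{array}\right. $$ satisfies $$ \|y(t)\|\le \Big(1+\frac{T}{2}\|\mathcal{F}_T\|\Big)e^{(2\gamma_0+3\gamma)T}e^{-\gamma t}\|y(0)\|\quad\text{for all } t>0, $$ where $\|\mathcal{F}_T\|=\|\mathcal{F}_T\|_{\mathcal{L}(L^2(\omega_1);L^2(\omega))}$.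
   Context: Setting: $\Omega\subset\mathbb{R}^d$, $d\ge1$, is a bounded domain with $C^2$ boundary; $V\in L^\infty(\Omega)$ is a nonzero function and $\gamma_0=\|V\|_{L^\infty(\Omega)}$; $Ay=\Delta y-Vy$ with $D(A)=H_0^1(\Omega)\cap H^2(\Omega)$, generating the $C_0$-semigroup $e^{tA}$ on $L^2(\Omega)$; $\omega,\omega_1\subset\Omega$ are nonempty open subsets; $\mathbf{1}_\omega:L^2(\omega)\to L^2(\Omega)$ is the zero extension operator and $\mathbf{1}_\omega^*$ its adjoint (restriction to $\omega$); similarly $\mathbf{1}_{\omega_1},\mathbf{1}_{\omega_1}^*$. $\|\cdot\|,\langle\cdot,\cdot\rangle$ are the norm and inner product of $L^2(\Omega)$; $\|\cdot\|_\omega,\langle\cdot,\cdot\rangle_\omega$ (resp. $\|\cdot\|_{\omega_1},\langle\cdot,\cdot\rangle_{\omega_1}$) those of $L^2(\omega)$ (resp. $L^2(\omega_1)$). $\chi_E$ is the characteristic function of $E$. Solutions are mild solutions. $\{\lambda_j\}_{j\ge1}$ are the eigenvalues of $-A$, ordered as $\lambda_1\le\lambda_2\le\cdots\le\lambda_m\le0<\lambda_{m+1}\le\cdots$, with corresponding eigenfunctions $\{\xi_j\}$ forming an orthonormal basis of $L^2(\Omega)$. It is assumed that $-A$ has at least one negative eigenvalue. $X_M=\mathrm{span}\{\xi_1,\dots,\xi_M\}$ and $P_M$ is the orthogonal projection of $L^2(\Omega)$ onto $X_M$. The constant $\tilde C_1$: $\tilde C_1=C_0/2$, where $C_0>0$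 is a fixed constant depending only on $\Omega,\omega,\omega_1$ (not on $V$) such that, for both $\hat\omega=\omega$ and $\hat\omega=\omega_1$, for every $M\in\mathbb{N}^+$ with $\lambda_M\ge0$ and every $\alpha\in\mathbb{R}^M$, one has $\alpha' B^{-1}\alpha\le e^{C_0(1+\gamma_0^{2/3}+\sqrt{\lambda_M})}|\alpha|^2$, where $B$ is the (positive definite) $M\times M$ matrix with entries $\int_{\hat\omega}\xi_i\xi_j\,dx$ and $|\cdot|$ is the Euclidean norm. Construction of $\mathcal{F}_T$: given $T>0$ and $\gamma>0$ let $\hat c_p=\max\{0,\lambda_{m+1}-3\gamma_0\}$; $N=\max\{j\in\mathbb{N}^+: \lambda_j<2\gamma+(\ln 9)/T\}$; $$C(\gamma,T)=\left(\frac{\tilde C_1+\sqrt{\tilde C_1^2+2T\big[\ln(9\sqrt N)+\tilde C_1(1+\gamma_0^{2/3})\big]+(4\gamma+3\gamma_0)T^2}}{T}\right)^2+\hat c_p;$$ $M=\max\{j\in\mathbb{N}^+:\lambda_j<C(\gamma,T)\}$; $\varepsilon_0=\frac{1}{9\sqrt N}e^{-(2\gamma+\frac32\gamma_0+\hat c_p)T}$. For $j=1,\dots,N$, let $f_j\in L^2(\omega)$ be the (unique) element of minimal norm $\|f\|_\omega$ among all $f\in L^2(\omega)$ such that the solution $y$ of $y'(t)-Ay(t)=\mathbf{1}_\omega f$ on $(0,T/2)$, $y(0)=\xi_j$ ($f$ being independent of time) satisfies $\|P_My(T/2)\|\le\varepsilon_0\|\xi_j\|$. Let $h_j\in L^2(\omega_1)$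 be the (unique) element of minimal norm $\|h\|_{\omega_1}$ among all $h\in L^2(\omega_1)$ such that the solution $z$ of the impulse equation $z'(t)-Az(t)=0$ on $(0,T/2)\setminus\{T/4\}$, $z(0)=\xi_j$, $z(T/4)=z(T/4-)+\mathbf{1}_{\omega_1}h$ satisfies $\|P_Mz(T/2)\|\le\varepsilon_0\|\xi_j\|$. The feedback law is $$\mathcal{F}_T(v)=-\sum_{j=1}^N\langle\mathbf{1}_{\omega_1}v,\mathbf{1}_{\omega_1}h_j\rangle f_j,\qquad v\in L^2(\omega_1).$$ (It depends on $\gamma$ as well as on $T$.) *)

theory Defs
  imports "HOL-Analysis.Analysis" "HOL-Probability.Essential_Supremum"
begin

section \<open>The Hilbert space of square integrable functions\<close>

definition sq_integrable :: "('a::euclidean_space \<Rightarrow> real) \<Rightarrow> bool" where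
  "sq_integrable f \<longleftrightarrow> f \<in> borel_measurable lebesgue \<and> integrable lebesgue (\<lambda>x. (f x)\<^sup>2)"

definition L2_eq :: "('a::euclidean_space \<Rightarrow> real) \<Rightarrow> ('a \<Rightarrow> real) \<Rightarrow> bool" where
  "L2_eq f g \<longleftrightarrow> sq_integrable f \<and> sq_integrable g \<and> (AE x in lebesgue. f x = g x)"

lemma sq_integrable_0: "sq_integrable (\<lambda>x. 0)"
  by (simp add: sq_integrable_def)

lemma sq_integrable_mult:
  assumes "sq_integrable f" "sq_integrable g"
  shows "integrable lebesgue (\<lambda>x. f x * g x)"
proof (rule Bochner_Integration.integrable_bound)
  show "integrable lebesgue (\<lambda>x. (f x)\<^sup>2 + (g x)\<^sup>2)"
    using assms by (auto simp: sq_integrable_def)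
  show "(\<lambda>x. f x * g x) \<in> borel_measurable lebesgue"
    using assms by (auto simp: sq_integrable_def)
  have "norm (a * b) \<le> norm (a\<^sup>2 + b\<^sup>2)" for a b :: real
  proof -
    have "2 * \<bar>a\<bar> * \<bar>b\<bar> \<le> a\<^sup>2 + b\<^sup>2" "0 \<le> \<bar>a\<bar> * \<bar>b\<bar>"
      using sum_squares_bound[of "\<bar>a\<bar>" "\<bar>b\<bar>"] by simp_all
    then have "\<bar>a\<bar> * \<bar>b\<bar> \<le> a\<^sup>2 + b\<^sup>2" by linarith
    then show ?thesis by (simp add: abs_mult)
  qed
  then show "AE x in lebesgue. norm (f x * g x) \<le> norm ((f x)\<^sup>2 + (g x)\<^sup>2)"
    by simp
qed

lemma sq_integrable_add:
  assumes "sq_integrable f" "sq_integrable g"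
  shows "sq_integrable (\<lambda>x. f x + g x)"
  using assms sq_integrable_mult[OF assms]
  by (auto simp: sq_integrable_def power2_sum mult.assoc)

lemma sq_integrable_cmult: "sq_integrable f \<Longrightarrow> sq_integrable (\<lambda>x. c * f x)"
  by (auto simp: sq_integrable_def power_mult_distrib)

lemma sq_integrable_diff:
  assumes "sq_integrable f" "sq_integrable g"
  shows "sq_integrable (\<lambda>x. f x - g x)"
  using sq_integrable_add[OF assms(1) sq_integrable_cmult[OF assms(2), of "-1"]] by simp

quotient_type (overloaded) 'a L2 = "'a::euclidean_space \<Rightarrow> real" / partial: L2_eq
proof (rule part_equivpI)
  show "\<exists>f::'a \<Rightarrow> real. L2_eq f f"
    using sq_integrable_0 by (auto simp: L2_eq_def)
  show "symp L2_eq"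
    by (auto simp: symp_def L2_eq_def elim: eventually_mono)
  show "transp L2_eq"
    unfolding transp_def L2_eq_def by (metis (mono_tags, lifting) AE_mp AE_I2)
qed

instantiation L2 :: (euclidean_space) real_inner
begin

lift_definition zero_L2 :: "'a L2" is "\<lambda>x. 0"
  by (simp add: L2_eq_def sq_integrable_0)

lift_definition plus_L2 :: "'a L2 \<Rightarrow> 'a L2 \<Rightarrow> 'a L2" is "\<lambda>f g x. f x + g x"
  by (auto simp: L2_eq_def sq_integrable_add)

lift_definition minus_L2 :: "'a L2 \<Rightarrow> 'a L2 \<Rightarrow> 'a L2" is "\<lambda>f g x. f x - g x"
  by (auto simp: L2_eq_def sq_integrable_diff)

lift_definition uminus_L2 :: "'a L2 \<Rightarrow> 'a L2" is "\<lambda>f x. - f x"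
  using sq_integrable_cmult[of _ "-1"] by (auto simp: L2_eq_def)

lift_definition scaleR_L2 :: "real \<Rightarrow> 'a L2 \<Rightarrow> 'a L2" is "\<lambda>c f x. c * f x"
  by (auto simp: L2_eq_def sq_integrable_cmult)

lift_definition inner_L2 :: "'a L2 \<Rightarrow> 'a L2 \<Rightarrow> real" is "\<lambda>f g. LINT x|lebesgue. f x * g x"
  unfolding L2_eq_def
  by (rule integral_cong_AE) (auto simp: sq_integrable_def)

definition norm_L2 :: "'a L2 \<Rightarrow> real" where "norm_L2 u = sqrt (inner u u)"

definition sgn_L2 :: "'a L2 \<Rightarrow> 'a L2" where "sgn_L2 u = inverse (norm u) *\<^sub>R u"

definition dist_L2 :: "'a L2 \<Rightarrow> 'a L2 \<Rightarrow> real" where "dist_L2 u v = norm (u - v)"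

definition uniformity_L2 :: "('a L2 \<times> 'a L2) filter" where
  "uniformity_L2 = (INF e\<in>{0<..}. principal {(u, v). dist u v < e})"

definition open_L2 :: "'a L2 set \<Rightarrow> bool" where
  "open_L2 U \<longleftrightarrow> (\<forall>u\<in>U. \<forall>\<^sub>F (u', v) in uniformity. u' = u \<longrightarrow> v \<in> U)"

instance
proof
  fix a b :: real and u v w :: "'a L2"
  show "u + v + w = u + (v + w)"
    by transfer (simp add: L2_eq_def sq_integrable_add add.assoc)
  show "u + v = v + u"
    by transfer (simp add: L2_eq_def sq_integrable_add add.commute)
  show "0 + u = u"
    by transfer (simp add: L2_eq_def)
  show "- u + u = 0"
    by transfer (simp add: L2_eq_def sq_integrable_0)
  show "u - v = u + - v"
    by transfer (simp add: L2_eq_def sq_integrable_diff)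
  show "a *\<^sub>R (u + v) = a *\<^sub>R u + a *\<^sub>R v"
    by transfer (simp add: L2_eq_def sq_integrable_add sq_integrable_cmult distrib_left
        flip: distrib_left)
  show "(a + b) *\<^sub>R u = a *\<^sub>R u + b *\<^sub>R u"
    by transfer (simp add: L2_eq_def sq_integrable_add sq_integrable_cmult distrib_right
        flip: distrib_right)
  show "a *\<^sub>R b *\<^sub>R u = (a * b) *\<^sub>R u"
    by transfer (simp add: L2_eq_def sq_integrable_cmult mult.assoc flip: mult.assoc)
  show "1 *\<^sub>R u = u"
    by transfer (simp add: L2_eq_def)
  show "inner u v = inner v u"
    by transfer (simp add: mult.commute)
  show "inner (u + v) w = inner u w + inner v w"
    by transfer (simp add: L2_eq_def distrib_right sq_integrable_mult)
  show "inner (a *\<^sub>R u) v = a * inner u v"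
    by transfer (simp add: mult.assoc)
  show "0 \<le> inner u u"
    by transfer simp
  show "inner u u = 0 \<longleftrightarrow> u = 0"
  proof transfer
    fix f :: "'a \<Rightarrow> real" assume "L2_eq f f"
    then have sq: "sq_integrable f" by (simp add: L2_eq_def)
    have "(LINT x|lebesgue. f x * f x) = 0 \<longleftrightarrow> (AE x in lebesgue. f x * f x = 0)"
      by (rule integral_nonneg_eq_0_iff_AE) (auto simp: sq_integrable_mult sq)
    then show "((LINT x|lebesgue. f x * f x) = 0) = L2_eq f (\<lambda>x. 0)"
      by (simp add: L2_eq_def sq sq_integrable_0)
  qed
qed (simp_all add: norm_L2_def sgn_L2_def dist_L2_def uniformity_L2_def open_L2_def)

end

lemma rep_L2_sq_integrable: "sq_integrable (rep_L2 u)"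
  using Quotient3_rep_reflp[OF Quotient3_L2, of u] by (simp add: L2_eq_def)

lemma L2_eq_rep_abs: "sq_integrable f \<Longrightarrow> L2_eq (rep_L2 (abs_L2 f)) f"
  using rep_abs_rsp_left[OF Quotient3_L2, of f f] by (simp add: L2_eq_def)

lemma abs_rep_L2: "abs_L2 (rep_L2 u) = u"
  by (rule Quotient3_abs_rep[OF Quotient3_L2])

lemma norm_abs_L2:
  assumes "sq_integrable f"
  shows "norm (abs_L2 f) = sqrt (LINT x|lebesgue. (f x)\<^sup>2)"
  using assms by (simp add: norm_L2_def inner_L2.abs_eq L2_eq_def power2_eq_square)

lemma abs_L2_diff:
  "sq_integrable f \<Longrightarrow> sq_integrable g \<Longrightarrow> abs_L2 f - abs_L2 g = abs_L2 (\<lambda>x. f x - g x)"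
  by (simp add: minus_L2.abs_eq L2_eq_def)

lemma nn_integral_abs_L2:
  assumes "sq_integrable f"
  shows "(\<integral>\<^sup>+x. ennreal ((f x)\<^sup>2) \<partial>lebesgue) = ennreal ((norm (abs_L2 f))\<^sup>2)"
  using assms by (subst nn_integral_eq_integral) (auto simp: sq_integrable_def norm_abs_L2)

lemma liminf_bound: "liminf (X::nat\<Rightarrow>ennreal) \<le> c" if "\<And>m. m \<ge> K \<Longrightarrow> X m \<le> c" for X c K
  by (rule Liminf_le) (use that in \<open>auto simp: eventually_sequentially\<close>)

instance L2 :: (euclidean_space) banach
proof
  fix X :: "nat \<Rightarrow> 'a L2" assume X: "Cauchy X"
  then have "\<forall>k. \<exists>K. \<forall>m\<ge>K. \<forall>n\<ge>K. dist (X m) (X n) < (1/2) ^ k"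
    unfolding Cauchy_def by simp
  then obtain K where K: "\<And>k m n. m \<ge> K k \<Longrightarrow> n \<ge> K k \<Longrightarrow> dist (X m) (X n) < (1/2) ^ k"
    by metis
  define r where "r k = k + (\<Sum>i\<le>k. K i)" for k
  have r: "strict_mono r"
    by (rule strict_monoI_Suc) (simp add: r_def)
  have rK: "r m \<ge> K k" if "m \<ge> k" for m k
    using member_le_sum[of k "{..m}" K] that by (simp add: r_def)
  define F where "F n = rep_L2 (X (r n))" for n
  have F: "sq_integrable (F n)" for n
    by (simp add: F_def rep_L2_sq_integrable)
  then have [measurable]: "F n \<in> borel_measurable lebesgue" for n
    by (simp add: sq_integrable_def)
  have dist_F: "norm (abs_L2 (\<lambda>x. F m x - F n x)) < (1/2) ^ k" if "m \<ge> k" "n \<ge> k" for m n k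
    using K[OF rK rK] that abs_L2_diff[OF F F] by (simp add: F_def abs_rep_L2 dist_norm)
  define D where "D k x = \<bar>F (Suc k) x - F k x\<bar>" for k x
  have D: "sq_integrable (D k)" for k
  proof -
    have "integrable lebesgue (\<lambda>x. (F (Suc k) x - F k x)\<^sup>2)"
      using sq_integrable_diff[OF F F] by (simp add: sq_integrable_def)
    moreover have "D k \<in> borel_measurable lebesgue"
      unfolding D_def by measurable
    ultimately show ?thesis
      by (simp add: sq_integrable_def D_def)
  qed
  have norm_D: "norm (abs_L2 (D k)) \<le> (1/2) ^ k" for k
  proof -
    have "norm (abs_L2 (D k)) = norm (abs_L2 (\<lambda>x. F (Suc k) x - F k x))"
      unfolding norm_abs_L2[OF D] norm_abs_L2[OF sq_integrable_diff[OF F F]] by (simp add: D_def)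
    then show ?thesis
      using dist_F[of k "Suc k" k] by simp
  qed
  define G where "G n x = (\<Sum>k<n. D k x)" for n x
  have G: "sq_integrable (G n) \<and> norm (abs_L2 (G n)) \<le> 2 - 2 * (1/2) ^ n" for n
  proof (induction n)
    case 0
    then show ?case by (simp add: G_def sq_integrable_0 flip: zero_L2.abs_eq)
  next
    case (Suc n)
    have eq: "G (Suc n) = (\<lambda>x. G n x + D n x)" by (auto simp: G_def)
    have "abs_L2 (G (Suc n)) = abs_L2 (G n) + abs_L2 (D n)"
      using Suc D by (simp add: plus_L2.abs_eq L2_eq_def eq)
    then show ?case
      using Suc D norm_D[of n] norm_triangle_ineq[of "abs_L2 (G n)" "abs_L2 (D n)"]
      by (auto simp: eq sq_integrable_add)
  qed
  have [measurable]: "G n \<in> borel_measurable lebesgue" for n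
    using G by (simp add: sq_integrable_def)
  have G_mono: "0 \<le> G n x" "G n x \<le> G (Suc n) x" for n x
    by (auto simp: G_def D_def intro!: sum_nonneg)
  have "(\<integral>\<^sup>+x. (SUP n. ennreal ((G n x)\<^sup>2)) \<partial>lebesgue)
      = (SUP n. (\<integral>\<^sup>+x. ennreal ((G n x)\<^sup>2) \<partial>lebesgue))"
    by (rule nn_integral_monotone_convergence_SUP)
       (auto intro!: incseq_SucI le_funI ennreal_leI power_mono G_mono)
  also have "\<dots> \<le> ennreal 4"
  proof (rule SUP_least)
    fix n
    have "norm (abs_L2 (G n)) \<le> 2"
      using G[of n] zero_le_power[of "1/2::real" n] by linarith
    then have "(norm (abs_L2 (G n)))\<^sup>2 \<le> 2\<^sup>2"
      by (intro power_mono) auto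
    then show "(\<integral>\<^sup>+x. ennreal ((G n x)\<^sup>2) \<partial>lebesgue) \<le> ennreal 4"
      using G by (simp add: nn_integral_abs_L2 ennreal_leI del: ennreal_numeral)
  qed
  finally have "(\<integral>\<^sup>+x. (SUP n. ennreal ((G n x)\<^sup>2)) \<partial>lebesgue) \<noteq> \<infinity>"
    by (auto simp: top_unique)
  then have "AE x in lebesgue. (SUP n. ennreal ((G n x)\<^sup>2)) \<noteq> \<infinity>"
    by (intro nn_integral_PInf_AE) auto
  then have conv: "AE x in lebesgue. convergent (\<lambda>n. F n x)"
  proof (eventually_elim)
    fix x assume fin: "(SUP n. ennreal ((G n x)\<^sup>2)) \<noteq> \<infinity>"
    then obtain c where c: "c \<ge> 0" "(SUP n. ennreal ((G n x)\<^sup>2)) = ennreal c"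
      by (cases "SUP n. ennreal ((G n x)\<^sup>2)") auto
    have le: "(G n x)\<^sup>2 \<le> c" for n
      using SUP_upper[of n UNIV "\<lambda>n. ennreal ((G n x)\<^sup>2)"] c by simp
    have "summable (\<lambda>k. D k x)"
    proof (rule summableI_nonneg_bounded)
      show "(\<Sum>i<n. D i x) \<le> sqrt c" for n
        using le[of n] real_le_rsqrt by (auto simp: G_def)
    qed (simp add: D_def)
    then have "summable (\<lambda>k. F (Suc k) x - F k x)"
      using summable_rabs_cancel[of "\<lambda>k. F (Suc k) x - F k x"] by (simp add: D_def)
    then have "convergent (\<lambda>n. \<Sum>k<n. F (Suc k) x - F k x)"
      by (simp add: summable_iff_convergent)
    then have "convergent (\<lambda>n. F n x - F 0 x)"
      unfolding sum_lessThan_telescope[of "\<lambda>k. F k x"] .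
    from convergent_add[OF this convergent_const[of "F 0 x"]]
    show "convergent (\<lambda>n. F n x)" by simp
  qed
  define f where "f x = lim (\<lambda>n. F n x)" for x
  have [measurable]: "f \<in> borel_measurable lebesgue"
    unfolding f_def by measurable
  have bound: "(\<integral>\<^sup>+x. ennreal ((F n x - f x)\<^sup>2) \<partial>lebesgue) \<le> ennreal (((1/2) ^ k)\<^sup>2)" if "n \<ge> k" for n k
  proof -
    have "(\<integral>\<^sup>+x. ennreal ((F n x - f x)\<^sup>2) \<partial>lebesgue)
        = (\<integral>\<^sup>+x. liminf (\<lambda>m. ennreal ((F n x - F m x)\<^sup>2)) \<partial>lebesgue)"
    proof (rule nn_integral_cong_AE, use conv in eventually_elim)
      fix x assume "convergent (\<lambda>n. F n x)"
      then have "(\<lambda>m. F m x) \<longlonglongrightarrow> f x"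
        by (simp add: f_def convergent_LIMSEQ_iff)
      then have "(\<lambda>m. ennreal ((F n x - F m x)\<^sup>2)) \<longlonglongrightarrow> ennreal ((F n x - f x)\<^sup>2)"
        by (intro tendsto_intros)
      then show "ennreal ((F n x - f x)\<^sup>2) = liminf (\<lambda>m. ennreal ((F n x - F m x)\<^sup>2))"
        by (intro lim_imp_Liminf[symmetric]) auto
    qed
    also have "\<dots> \<le> liminf (\<lambda>m. \<integral>\<^sup>+x. ennreal ((F n x - F m x)\<^sup>2) \<partial>lebesgue)"
      by (intro nn_integral_liminf) auto
    also have "\<dots> \<le> ennreal (((1/2) ^ k)\<^sup>2)"
    proof (rule liminf_bound)
      fix m assume "m \<ge> k"
      then have "(norm (abs_L2 (\<lambda>x. F n x - F m x)))\<^sup>2 \<le> ((1/2) ^ k)\<^sup>2"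
        using dist_F[OF that] by (intro power_mono) (auto intro: less_imp_le)
      then show "(\<integral>\<^sup>+x. ennreal ((F n x - F m x)\<^sup>2) \<partial>lebesgue) \<le> ennreal (((1/2) ^ k)\<^sup>2)"
        by (subst nn_integral_abs_L2[OF sq_integrable_diff[OF F F]]) (rule ennreal_leI)
    qed
    finally show ?thesis .
  qed
  have diff: "sq_integrable (\<lambda>x. F n x - f x)" for n
    unfolding sq_integrable_def
  proof (intro conjI integrableI_bounded)
    show "(\<integral>\<^sup>+x. ennreal (norm ((F n x - f x)\<^sup>2)) \<partial>lebesgue) < \<infinity>"
      using bound[OF order_refl[of n]] by (simp add: order.strict_trans1[OF _ ennreal_less_top])
  qed auto
  have f: "sq_integrable f"
    using sq_integrable_diff[OF F[of 0] diff[of 0]] by simp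
  have "norm (X (r n) - abs_L2 f) \<le> (1/2) ^ n" for n
  proof -
    have "X (r n) - abs_L2 f = abs_L2 (\<lambda>x. F n x - f x)"
      using abs_L2_diff[OF F[of n] f] by (simp add: F_def abs_rep_L2)
    then have "ennreal ((norm (X (r n) - abs_L2 f))\<^sup>2) \<le> ennreal (((1/2) ^ n)\<^sup>2)"
      using bound[OF order_refl[of n]] by (simp add: nn_integral_abs_L2[OF diff])
    then show ?thesis
      by simp
  qed
  then have "\<forall>\<^sub>F n in sequentially. norm (X (r n) - abs_L2 f) \<le> (1/2) ^ n"
    by simp
  moreover have "(\<lambda>n. (1/2::real) ^ n) \<longlonglongrightarrow> 0"
    by (rule LIMSEQ_realpow_zero) auto
  ultimately have "(\<lambda>n. X (r n) - abs_L2 f) \<longlonglongrightarrow> 0"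
    by (rule Lim_null_comparison)
  then have "(X \<circ> r) \<longlonglongrightarrow> abs_L2 f"
    by (simp add: LIM_zero_iff o_def)
  then show "convergent X"
    using Cauchy_converges_subseq[OF X r] by (auto simp: convergent_def)
qed

text \<open>
  Every set \<open>E\<close> below is an open subset of the ambient space. The space \<open>L\<^sup>2(E)\<close> is realised as
  the closed subspace of \<open>L\<^sup>2\<close> consisting of the classes that vanish almost everywhere outside \<open>E\<close>,
  with the inherited inner product. Zero extension \<open>L\<^sup>2(E) \<rightarrow> L\<^sup>2(\<Omega>)\<close> is then the inclusion and is not
  written; its adjoint is \<open>restr E\<close>.
\<close>

definition L2_on :: "'a::euclidean_space set \<Rightarrow> 'a L2 set" where
  "L2_on E = {u. AE x in lebesgue. x \<notin> E \<longrightarrow> rep_L2 u x = 0}"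

definition mult_L2 :: "('a::euclidean_space \<Rightarrow> real) \<Rightarrow> 'a L2 \<Rightarrow> 'a L2" where
  "mult_L2 p u = abs_L2 (\<lambda>x. p x * rep_L2 u x)"

definition restr :: "'a::euclidean_space set \<Rightarrow> 'a L2 \<Rightarrow> 'a L2" where
  "restr E = mult_L2 (indicator E)"

definition Linf_norm :: "'a::euclidean_space set \<Rightarrow> ('a \<Rightarrow> real) \<Rightarrow> real" where
  "Linf_norm \<Omega> V = real_of_ereal (esssup (lebesgue_on \<Omega>) (\<lambda>x. ereal \<bar>V x\<bar>))"

definition Linf_on :: "'a::euclidean_space set \<Rightarrow> ('a \<Rightarrow> real) set" where
  "Linf_on \<Omega> = {V. V \<in> borel_measurable (lebesgue_on \<Omega>)
     \<and> esssup (lebesgue_on \<Omega>) (\<lambda>x. ereal \<bar>V x\<bar>) < \<infinity>}"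


section \<open>Domains and Sobolev spaces\<close>

definition partial :: "'a::euclidean_space \<Rightarrow> ('a \<Rightarrow> real) \<Rightarrow> 'a \<Rightarrow> real" where
  "partial i f x = frechet_derivative f (at x) i"

primrec Ck :: "nat \<Rightarrow> ('a::euclidean_space \<Rightarrow> real) \<Rightarrow> bool" where
  "Ck 0 f \<longleftrightarrow> continuous_on UNIV f"
| "Ck (Suc k) f \<longleftrightarrow> (\<forall>x. f differentiable (at x)) \<and> (\<forall>i\<in>Basis. Ck k (partial i f))"

text \<open>
  Near each boundary point the domain is, after a rigid motion, the region above the graph of a
  \<open>C\<^sup>2\<close> function of the coordinates orthogonal to the direction \<open>e\<close>.
\<close>

definition C2_boundary :: "'a::euclidean_space set \<Rightarrow> bool" where
  "C2_boundary \<Omega> \<longleftrightarrow> (\<forall>p\<in>frontier \<Omega>. \<exists>r>0. \<exists>e g. norm e = 1 \<and> Ck 2 g \<and>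
     \<Omega> \<inter> ball p r = {x \<in> ball p r. g (x - (x \<bullet> e) *\<^sub>R e) < x \<bullet> e})"

definition bounded_C2_domain :: "'a::euclidean_space set \<Rightarrow> bool" where
  "bounded_C2_domain \<Omega> \<longleftrightarrow>
     \<Omega> \<noteq> {} \<and> open \<Omega> \<and> connected \<Omega> \<and> bounded \<Omega> \<and> C2_boundary \<Omega>"

definition test_fun :: "'a::euclidean_space set \<Rightarrow> ('a \<Rightarrow> real) \<Rightarrow> bool" where
  "test_fun \<Omega> \<phi> \<longleftrightarrow>
     (\<forall>k. Ck k \<phi>) \<and> compact (closure {x. \<phi> x \<noteq> 0}) \<and> closure {x. \<phi> x \<noteq> 0} \<subseteq> \<Omega>"

definition weak_partial :: "'a::euclidean_space set \<Rightarrow> 'a \<Rightarrow> 'a L2 \<Rightarrow> 'a L2 \<Rightarrow> bool" where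
  "weak_partial \<Omega> i u g \<longleftrightarrow> u \<in> L2_on \<Omega> \<and> g \<in> L2_on \<Omega> \<and>
     (\<forall>\<phi>. test_fun \<Omega> \<phi> \<longrightarrow> u \<bullet> abs_L2 (partial i \<phi>) = - (g \<bullet> abs_L2 \<phi>))"

definition H1 :: "'a::euclidean_space set \<Rightarrow> 'a L2 set" where
  "H1 \<Omega> = {u. \<forall>i\<in>Basis. \<exists>g. weak_partial \<Omega> i u g}"

definition H2 :: "'a::euclidean_space set \<Rightarrow> 'a L2 set" where
  "H2 \<Omega> = {u. \<forall>i\<in>Basis. \<exists>g\<in>H1 \<Omega>. weak_partial \<Omega> i u g}"

text \<open>The closure of the test functions in the norm of \<open>H\<^sup>1(\<Omega>)\<close>.\<close>

definition H10 :: "'a::euclidean_space set \<Rightarrow> 'a L2 set" where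
  "H10 \<Omega> = {u \<in> H1 \<Omega>. \<exists>\<phi>. (\<forall>n. test_fun \<Omega> (\<phi> n)) \<and> (\<lambda>n. abs_L2 (\<phi> n)) \<longlonglongrightarrow> u \<and>
     (\<forall>i\<in>Basis. \<exists>g. weak_partial \<Omega> i u g \<and> (\<lambda>n. abs_L2 (partial i (\<phi> n))) \<longlonglongrightarrow> g)}"

definition weak_laplacian :: "'a::euclidean_space set \<Rightarrow> 'a L2 \<Rightarrow> 'a L2 \<Rightarrow> bool" where
  "weak_laplacian \<Omega> u w \<longleftrightarrow> (\<exists>g h.
     (\<forall>i\<in>Basis. weak_partial \<Omega> i u (g i) \<and> weak_partial \<Omega> i (g i) (h i)) \<and> w = (\<Sum>i\<in>Basis. h i))"

text \<open>
  Unbounded operators are given by their graphs. The potential \<open>V\<close> is only meaningful on \<open>\<Omega>\<close>, whence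
  the indicator.
\<close>

definition schroedinger_op :: "'a::euclidean_space set \<Rightarrow> ('a \<Rightarrow> real) \<Rightarrow> ('a L2 \<times> 'a L2) set" where
  "schroedinger_op \<Omega> V = {(u, w - mult_L2 (\<lambda>x. indicator \<Omega> x * V x) u) | u w.
     u \<in> H10 \<Omega> \<inter> H2 \<Omega> \<and> weak_laplacian \<Omega> u w}"


section \<open>Semigroups and mild solutions\<close>

definition C0_semigroup_on ::
    "'b::real_normed_vector set \<Rightarrow> (real \<Rightarrow> 'b \<Rightarrow> 'b) \<Rightarrow> bool" where
  "C0_semigroup_on X S \<longleftrightarrow>
     (\<forall>t\<ge>0. \<forall>u\<in>X. S t u \<in> X) \<and>
     (\<forall>t\<ge>0. \<forall>u\<in>X. \<forall>v\<in>X. S t (u + v) = S t u + S t v) \<and>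
     (\<forall>t\<ge>0. \<forall>c. \<forall>u\<in>X. S t (c *\<^sub>R u) = c *\<^sub>R S t u) \<and>
     (\<forall>t\<ge>0. \<exists>K. \<forall>u\<in>X. norm (S t u) \<le> K * norm u) \<and>
     (\<forall>u\<in>X. S 0 u = u) \<and>
     (\<forall>s\<ge>0. \<forall>t\<ge>0. \<forall>u\<in>X. S (s + t) u = S s (S t u)) \<and>
     (\<forall>u\<in>X. ((\<lambda>t. S t u) \<longlongrightarrow> u) (at_right 0))"

definition generator_on ::
    "'b::real_normed_vector set \<Rightarrow> (real \<Rightarrow> 'b \<Rightarrow> 'b) \<Rightarrow> ('b \<times> 'b) set" where
  "generator_on X S = {(u, w). u \<in> X \<and> ((\<lambda>t. (S t u - u) /\<^sub>R t) \<longlongrightarrow> w) (at_right 0)}"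

text \<open>
  \<open>y\<close> is the mild solution of \<open>y' - A y = u\<close>, \<open>y 0 = y0\<close> on the time set \<open>I\<close>. The forcings used are
  piecewise constant in time, so that this integral agrees with the Bochner integral.
\<close>

definition mild_solution ::
    "(real \<Rightarrow> 'b::real_normed_vector \<Rightarrow> 'b) \<Rightarrow> real set \<Rightarrow> 'b \<Rightarrow> (real \<Rightarrow> 'b) \<Rightarrow> (real \<Rightarrow> 'b) \<Rightarrow> bool" where
  "mild_solution S I y0 u y \<longleftrightarrow>
     (\<forall>t\<in>I. ((\<lambda>s. S (t - s) (u s)) has_integral (y t - S t y0)) {0..t})"

text \<open>The impulse \<open>h\<close> acts at time \<open>\<tau>\<close>; there is no other forcing on \<open>{0..b}\<close>.\<close>

definition impulse_solution ::
    "(real \<Rightarrow> 'b::real_normed_vector \<Rightarrow> 'b) \<Rightarrow> real \<Rightarrow> real \<Rightarrow> 'b \<Rightarrow> 'b \<Rightarrow> (real \<Rightarrow> 'b) \<Rightarrow> bool" where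
  "impulse_solution S \<tau> b z0 h z \<longleftrightarrow>
     (\<forall>t\<in>{0..<\<tau>}. z t = S t z0) \<and>
     (\<exists>l. (z \<longlongrightarrow> l) (at_left \<tau>) \<and> z \<tau> = l + h) \<and>
     (\<forall>t\<in>{\<tau>..b}. z t = S (t - \<tau>) (z \<tau>))"


section \<open>Spectral data\<close>

text \<open>Families indexed by \<open>j = 1, 2, \<dots>\<close> are functions on \<open>nat\<close> whose value at \<open>0\<close> plays no role.\<close>

definition spectral_data ::
    "'a::euclidean_space set \<Rightarrow> ('a \<Rightarrow> real) \<Rightarrow> (nat \<Rightarrow> real) \<Rightarrow> (nat \<Rightarrow> 'a L2) \<Rightarrow> nat \<Rightarrow> bool" where
  "spectral_data \<Omega> V lam \<xi> m \<longleftrightarrow>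
     (\<forall>j\<ge>1. (\<xi> j, - lam j *\<^sub>R \<xi> j) \<in> schroedinger_op \<Omega> V) \<and>
     (\<forall>i\<ge>1. \<forall>j\<ge>1. \<xi> i \<bullet> \<xi> j = (if i = j then 1 else 0)) \<and>
     closure (span (\<xi> ` {1..})) = L2_on \<Omega> \<and>
     (\<forall>i\<ge>1. \<forall>j\<ge>i. lam i \<le> lam j) \<and>
     (\<exists>j\<ge>1. lam j < 0) \<and>
     1 \<le> m \<and> lam m \<le> 0 \<and> 0 < lam (Suc m)"

definition gram :: "'a::euclidean_space set \<Rightarrow> (nat \<Rightarrow> 'a L2) \<Rightarrow> nat \<Rightarrow> nat \<Rightarrow> real" where
  "gram E \<xi> i j = (LINT x:E|lebesgue. rep_L2 (\<xi> i) x * rep_L2 (\<xi> j) x)"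

text \<open>\<open>M \<times> M\<close> matrices are functions of two indices in \<open>{1..M}\<close>.\<close>

definition inverse_matrix :: "nat \<Rightarrow> (nat \<Rightarrow> nat \<Rightarrow> real) \<Rightarrow> (nat \<Rightarrow> nat \<Rightarrow> real) \<Rightarrow> bool" where
  "inverse_matrix M B C \<longleftrightarrow> (\<forall>i\<in>{1..M}. \<forall>j\<in>{1..M}.
     (\<Sum>k=1..M. B i k * C k j) = (if i = j then 1 else 0) \<and>
     (\<Sum>k=1..M. C i k * B k j) = (if i = j then 1 else 0))"

text \<open>The constant \<open>C0\<close> is uniform in the potential.\<close>

definition spectral_constant ::
    "'a::euclidean_space set \<Rightarrow> 'a set \<Rightarrow> 'a set \<Rightarrow> real \<Rightarrow> bool" where
  "spectral_constant \<Omega> \<omega> \<omega>1 C0 \<longleftrightarrow> C0 > 0 \<and>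
     (\<forall>V lam \<xi> m. V \<in> Linf_on \<Omega> \<and> \<not> (AE x in lebesgue_on \<Omega>. V x = 0) \<and> spectral_data \<Omega> V lam \<xi> m \<longrightarrow>
       (\<forall>E\<in>{\<omega>, \<omega>1}. \<forall>M\<ge>1. lam M \<ge> 0 \<longrightarrow>
         (\<exists>C. inverse_matrix M (gram E \<xi>) C \<and>
           (\<forall>\<alpha>::nat \<Rightarrow> real. (\<Sum>i=1..M. \<Sum>j=1..M. \<alpha> i * C i j * \<alpha> j)
              \<le> exp (C0 * (1 + Linf_norm \<Omega> V powr (2/3) + sqrt (lam M))) * (\<Sum>i=1..M. (\<alpha> i)\<^sup>2)))))"


section \<open>The feedback law\<close>

definition is_greatest :: "nat set \<Rightarrow> nat \<Rightarrow> bool" where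
  "is_greatest A n \<longleftrightarrow> n \<in> A \<and> (\<forall>k\<in>A. k \<le> n)"

definition orth_proj :: "'b::real_inner set \<Rightarrow> 'b \<Rightarrow> 'b" where
  "orth_proj X u = (THE p. p \<in> X \<and> (\<forall>v\<in>X. (u - p) \<bullet> v = 0))"

definition threshold ::
    "real \<Rightarrow> real \<Rightarrow> real \<Rightarrow> nat \<Rightarrow> real \<Rightarrow> real \<Rightarrow> real" where
  "threshold C1 \<gamma>0 cp N \<gamma> T =
     ((C1 + sqrt (C1\<^sup>2 + 2 * T * (ln (9 * sqrt (real N)) + C1 * (1 + \<gamma>0 powr (2/3)))
                  + (4 * \<gamma> + 3 * \<gamma>0) * T\<^sup>2)) / T)\<^sup>2 + cp"

definition tolerance :: "real \<Rightarrow> real \<Rightarrow> nat \<Rightarrow> real \<Rightarrow> real \<Rightarrow> real" where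
  "tolerance \<gamma>0 cp N \<gamma> T =
     1 / (9 * sqrt (real N)) * exp (- (2 * \<gamma> + 3 / 2 * \<gamma>0 + cp) * T)"

definition distributed_controls ::
    "(real \<Rightarrow> 'a::euclidean_space L2 \<Rightarrow> 'a L2) \<Rightarrow> 'a set \<Rightarrow> 'a L2 set \<Rightarrow> real \<Rightarrow> real \<Rightarrow> 'a L2 \<Rightarrow> 'a L2 set" where
  "distributed_controls S \<omega> X \<epsilon> T x0 = {f \<in> L2_on \<omega>. \<exists>y.
     mild_solution S {0..T/2} x0 (\<lambda>s. f) y \<and> norm (orth_proj X (y (T/2))) \<le> \<epsilon> * norm x0}"

definition impulse_controls ::
    "(real \<Rightarrow> 'a::euclidean_space L2 \<Rightarrow> 'a L2) \<Rightarrow> 'a set \<Rightarrow> 'a L2 set \<Rightarrow> real \<Rightarrow> real \<Rightarrow> 'a L2 \<Rightarrow> 'a L2 set" where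
  "impulse_controls S \<omega>1 X \<epsilon> T x0 = {h \<in> L2_on \<omega>1. \<exists>z.
     impulse_solution S (T/4) (T/2) x0 h z \<and> norm (orth_proj X (z (T/2))) \<le> \<epsilon> * norm x0}"

definition feedback ::
    "nat \<Rightarrow> (nat \<Rightarrow> 'b::real_inner) \<Rightarrow> (nat \<Rightarrow> 'b) \<Rightarrow> 'b \<Rightarrow> 'b" where
  "feedback N f h v = - (\<Sum>j=1..N. (v \<bullet> h j) *\<^sub>R f j)"

definition op_norm_on :: "'b::real_normed_vector set \<Rightarrow> ('b \<Rightarrow> 'b) \<Rightarrow> real" where
  "op_norm_on X F = (SUP v\<in>{v \<in> X. norm v \<le> 1}. norm (F v))"

definition closed_loop_forcing ::
    "'a::euclidean_space set \<Rightarrow> ('a L2 \<Rightarrow> 'a L2) \<Rightarrow> real \<Rightarrow> (real \<Rightarrow> 'a L2) \<Rightarrow> real \<Rightarrow> 'a L2" where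
  "closed_loop_forcing \<omega>1 F T y t =
     (\<Sum>i. indicator {(2 * real i + 1) * T ..< (2 * real i + 3/2) * T} t
            *\<^sub>R F (restr \<omega>1 (y ((2 * real i + 3/4) * T))))"

end

theory Submission
  imports Defs
begin

text \<open>
  On \<open>L\<^sup>2(\<Omega>)\<close> the semigroup is diagonal in the orthonormal basis \<open>\<xi>\<close>, with factors \<open>exp (- lam j * t)\<close>,
  and \<open>lam j \<ge> - \<gamma>0\<close> for all \<open>j\<close>. Write \<open>y0\<close> for the state at the beginning of a period of length
  \<open>2 T\<close>, \<open>c j = y0 \<bullet> \<xi> j\<close>, \<open>E j = exp (- lam j * T)\<close>, and let \<open>Y j\<close>, \<open>Z j\<close> be the states at time \<open>T\<close> that
  are reached from \<open>\<xi> j\<close> when the control \<open>f j\<close>, respectively the impulse \<open>h j\<close>, acts during the first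
  half of \<open>[0, T]\<close>. The two control problems are adjoint to each other in such a way that the state
  at the end of the period is
  \<open>S (2 T) (y0 - \<Sum>j\<le>N. c j \<xi> j) + (\<Sum>j\<le>N. E j c j Y j + (y0 \<bullet> Z j) E j \<xi> j - (y0 \<bullet> Z j) Y j)\<close>: the components of
  the uncontrolled state along \<open>\<xi> 1, \<dots>, \<xi> N\<close> cancel exactly (lemma \<open>period_contraction\<close>). The first term
  is small because all modes beyond \<open>N\<close> decay faster than \<open>2 \<gamma> + ln 9 / T\<close>; the others are small because \<open>Y j\<close> and \<open>Z j\<close>
  are. The total factor is at most \<open>(1 + 4 + 18 + 18) / 81\<close> times \<open>exp (- 2 \<gamma> T)\<close>
  (lemma \<open>contraction_factor_le\<close>).

  To see that \<open>Y j\<close> and \<open>Z j\<close> are small, split them at mode \<open>M\<close> (lemma \<open>norm_steered_le\<close>). The low part is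
  within the tolerance by the choice of the controls. The high part is the contribution of the
  control alone, damped by \<open>exp (- C T / 2)\<close>, where \<open>C\<close> is the threshold that defines \<open>M\<close>. The
  controls have minimal norm, so that any competitor bounds them: the spectral inequality yields an
  element supported in the control region that is dual to \<open>\<xi> j\<close> among \<open>\<xi> 1, \<dots>, \<xi> M\<close>
  (lemma \<open>dual_element\<close>), and a multiple of it annihilates the low part altogether
  (lemmas \<open>distributed_steering\<close> and \<open>impulse_steering\<close>). The cost grows like \<open>exp (C0 / 2 * sqrt C)\<close>, which
  the damping beats; the threshold is the solution of the corresponding quadratic equation
  (lemmas \<open>high_mode_exponent\<close> and \<open>steering_budget\<close>).

  Iterating the contraction over the periods, and bounding the trajectory inside a period by
  \<open>(1 + T / 2 * norm F) * exp (2 \<gamma>0 T)\<close> times the initial state of the period, gives the decay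
  (lemma \<open>closed_loop_decay\<close>).

  Two facts about the given data have to be derived first. The lower bound on the eigenvalues is
  integration by parts (lemma \<open>inner_weak_laplacian_nonpos\<close>). That \<open>S t (\<xi> j) = exp (- lam j * t) \<xi> j\<close> follows
  from the generator being the Schroedinger operator, through the local boundedness of the
  semigroup (lemma \<open>semigroup_eigenvector\<close>).
\<close>


section \<open>Multiplication and restriction on the space of square integrable functions\<close>

lemma sq_integrable_bounded_mult:
  fixes p f :: "'a::euclidean_space \<Rightarrow> real"
  assumes "p \<in> borel_measurable lebesgue" "AE x in lebesgue. \<bar>p x\<bar> \<le> B" "sq_integrable f"
  shows "sq_integrable (\<lambda>x. p x * f x)"
  unfolding sq_integrable_def
proof
  show meas: "(\<lambda>x. p x * f x) \<in> borel_measurable lebesgue"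
    using assms by (auto simp: sq_integrable_def)
  show "integrable lebesgue (\<lambda>x. (p x * f x)\<^sup>2)"
  proof (rule Bochner_Integration.integrable_bound)
    show "integrable lebesgue (\<lambda>x. B\<^sup>2 * (f x)\<^sup>2)"
      using assms by (auto simp: sq_integrable_def)
    show "(\<lambda>x. (p x * f x)\<^sup>2) \<in> borel_measurable lebesgue"
      using meas by simp
    show "AE x in lebesgue. norm ((p x * f x)\<^sup>2) \<le> norm (B\<^sup>2 * (f x)\<^sup>2)"
      using assms(2)
    proof eventually_elim
      fix x assume "\<bar>p x\<bar> \<le> B"
      then have "\<bar>p x\<bar>\<^sup>2 \<le> B\<^sup>2" by (intro power_mono) auto
      then show "norm ((p x * f x)\<^sup>2) \<le> norm (B\<^sup>2 * (f x)\<^sup>2)"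
        by (simp add: power_mult_distrib mult_right_mono)
    qed
  qed
qed

lemma inner_L2_eq_integral: "u \<bullet> v = (LINT x|lebesgue. rep_L2 u x * rep_L2 v x)"
proof -
  have "abs_L2 (rep_L2 u) \<bullet> abs_L2 (rep_L2 v) = (LINT x|lebesgue. rep_L2 u x * rep_L2 v x)"
    by (rule inner_L2.abs_eq) (simp_all add: L2_eq_def rep_L2_sq_integrable)
  then show ?thesis by (simp add: abs_rep_L2)
qed

lemma abs_L2_eq_iff:
  assumes "sq_integrable f" "sq_integrable g"
  shows "abs_L2 f = abs_L2 g \<longleftrightarrow> (AE x in lebesgue. f x = g x)"
  using assms Quotient3_rel[OF Quotient3_L2, of f g] by (auto simp: L2_eq_def)

lemma inner_mult_L2:
  assumes "p \<in> borel_measurable lebesgue" "AE x in lebesgue. \<bar>p x\<bar> \<le> B"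
  shows "mult_L2 p u \<bullet> v = (LINT x|lebesgue. p x * (rep_L2 u x * rep_L2 v x))"
proof -
  have "abs_L2 (\<lambda>x. p x * rep_L2 u x) \<bullet> abs_L2 (rep_L2 v)
      = (LINT x|lebesgue. p x * rep_L2 u x * rep_L2 v x)"
    by (rule inner_L2.abs_eq)
       (simp_all add: L2_eq_def rep_L2_sq_integrable sq_integrable_bounded_mult[OF assms])
  then show ?thesis by (simp add: abs_rep_L2 mult_L2_def mult.assoc)
qed

lemma abs_inner_mult_L2_le:
  assumes "p \<in> borel_measurable lebesgue" "AE x in lebesgue. \<bar>p x\<bar> \<le> B"
  shows "\<bar>mult_L2 p u \<bullet> u\<bar> \<le> B * (norm u)\<^sup>2"
proof -
  let ?f = "rep_L2 u"
  have f: "sq_integrable ?f" by (rule rep_L2_sq_integrable)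
  have pf: "integrable lebesgue (\<lambda>x. p x * ?f x * ?f x)"
    by (intro sq_integrable_mult f sq_integrable_bounded_mult[OF assms])
  have "\<bar>LINT x|lebesgue. p x * ?f x * ?f x\<bar> \<le> (LINT x|lebesgue. \<bar>p x * ?f x * ?f x\<bar>)"
    by (rule integral_abs_bound)
  also have "\<dots> \<le> (LINT x|lebesgue. B * (?f x * ?f x))"
  proof (rule integral_mono_AE)
    show "AE x in lebesgue. \<bar>p x * ?f x * ?f x\<bar> \<le> B * (?f x * ?f x)"
      using assms(2) by eventually_elim (simp add: abs_mult mult.assoc mult_right_mono)
  qed (use pf sq_integrable_mult[OF f f] in auto)
  also have "\<dots> = B * (norm u)\<^sup>2"
    by (simp add: power2_norm_eq_inner inner_L2_eq_integral)
  finally show ?thesis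
    by (simp add: inner_mult_L2[OF assms] mult.assoc)
qed

lemma inner_mult_L2_sym:
  assumes "p \<in> borel_measurable lebesgue" "AE x in lebesgue. \<bar>p x\<bar> \<le> B"
  shows "mult_L2 p u \<bullet> v = u \<bullet> mult_L2 p v"
proof -
  have "mult_L2 p v \<bullet> u = mult_L2 p u \<bullet> v"
    unfolding inner_mult_L2[OF assms] by (simp add: mult.commute mult.left_commute)
  then show ?thesis by (simp add: inner_commute)
qed

lemma bounded_indicator_lebesgue:
  assumes "E \<in> sets lebesgue"
  shows "(indicator E :: 'a::euclidean_space \<Rightarrow> real) \<in> borel_measurable lebesgue"
    and "AE x in lebesgue. \<bar>indicator E x :: real\<bar> \<le> 1"
  using assms by (auto simp: indicator_def)

lemma inner_restr_left:
  assumes "E \<in> sets lebesgue"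
  shows "restr E u \<bullet> v = u \<bullet> restr E v"
  unfolding restr_def by (rule inner_mult_L2_sym[OF bounded_indicator_lebesgue[OF assms]])

text \<open>Thus \<open>L2_on E\<close> is the range of the orthogonal projection \<open>restr E\<close>; membership becomes an equation
  between bounded operators.\<close>

lemma L2_on_iff_restr:
  assumes "E \<in> sets lebesgue"
  shows "u \<in> L2_on E \<longleftrightarrow> restr E u = u"
proof -
  have "restr E u = u \<longleftrightarrow> abs_L2 (\<lambda>x. indicator E x * rep_L2 u x) = abs_L2 (rep_L2 u)"
    by (simp add: restr_def mult_L2_def abs_rep_L2)
  also have "\<dots> \<longleftrightarrow> (AE x in lebesgue. indicator E x * rep_L2 u x = rep_L2 u x)"
    by (rule abs_L2_eq_iff)
       (intro sq_integrable_bounded_mult[OF bounded_indicator_lebesgue[OF assms]]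
         rep_L2_sq_integrable)+
  also have "\<dots> \<longleftrightarrow> u \<in> L2_on E"
    by (auto simp: L2_on_def indicator_def elim!: eventually_mono split: if_splits)
  finally show ?thesis by simp
qed

lemma restr_in_L2_on:
  assumes "E \<in> sets lebesgue"
  shows "restr E u \<in> L2_on E"
proof -
  let ?g = "\<lambda>x. indicator E x * rep_L2 u x"
  have "sq_integrable ?g"
    by (intro sq_integrable_bounded_mult[OF bounded_indicator_lebesgue[OF assms]]
         rep_L2_sq_integrable)
  then have "AE x in lebesgue. rep_L2 (restr E u) x = ?g x"
    using L2_eq_rep_abs by (auto simp: restr_def mult_L2_def L2_eq_def)
  then show ?thesis
    by (auto simp: L2_on_def elim!: eventually_mono)
qed

lemma norm_restr_le:
  assumes "E \<in> sets lebesgue"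
  shows "norm (restr E u) \<le> norm u"
proof (cases "restr E u = 0")
  case False
  have "(norm (restr E u))\<^sup>2 = u \<bullet> restr E u"
    using restr_in_L2_on[OF assms, of u]
    by (simp add: power2_norm_eq_inner inner_restr_left[OF assms] L2_on_iff_restr[OF assms])
  also have "\<dots> \<le> norm u * norm (restr E u)" by (rule norm_cauchy_schwarz)
  finally show ?thesis using False by (simp add: power2_eq_square)
qed simp

text \<open>Linearity costs no almost-everywhere argument: it is inherited from the other slot of the
  inner product through symmetry.\<close>

lemma bounded_linear_restr:
  assumes "E \<in> sets lebesgue"
  shows "bounded_linear (restr E)"
proof (rule bounded_linear_intro[where K = 1])
  have eqI: "u = v" if "\<And>w. u \<bullet> w = v \<bullet> w" for u v :: "'a L2"
  proof -
    have "(u - v) \<bullet> (u - v) = 0" unfolding inner_diff_left[of u v] using that by simp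
    then show ?thesis by simp
  qed
  show "restr E (u + v) = restr E u + restr E v" for u v
    by (rule eqI) (simp add: inner_restr_left[OF assms] inner_add_left)
  show "restr E (c *\<^sub>R u) = c *\<^sub>R restr E u" for c u
    by (rule eqI) (simp add: inner_restr_left[OF assms])
  show "norm (restr E u) \<le> norm u * 1" for u
    using norm_restr_le[OF assms] by simp
qed

lemma L2_on_mono: "E \<subseteq> D \<Longrightarrow> L2_on E \<subseteq> L2_on D"
  by (auto simp: L2_on_def elim!: eventually_mono)

lemma subspace_L2_on:
  assumes "E \<in> sets lebesgue"
  shows "subspace (L2_on E)"
proof -
  interpret bounded_linear "restr E" by (rule bounded_linear_restr[OF assms])
  show ?thesis by (auto simp: subspace_def L2_on_iff_restr[OF assms] add zero scaleR)
qed

lemma gram_eq_inner_restr: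
  assumes "E \<in> sets lebesgue"
  shows "gram E \<xi> i j = restr E (\<xi> i) \<bullet> \<xi> j"
  unfolding gram_def restr_def inner_mult_L2[OF bounded_indicator_lebesgue[OF assms]]
    set_lebesgue_integral_def by simp


section \<open>The spectrum is bounded below by the negative of the potential's norm\<close>

text \<open>The maximum with \<open>0\<close> serves the points outside \<open>\<Omega>\<close>.\<close>

lemma AE_Linf_norm:
  fixes V :: "'a::euclidean_space \<Rightarrow> real"
  assumes "\<Omega> \<in> sets lebesgue" "V \<in> Linf_on \<Omega>"
  shows "(\<lambda>x. indicator \<Omega> x * V x) \<in> borel_measurable lebesgue"
    and "AE x in lebesgue. \<bar>indicator \<Omega> x * V x\<bar> \<le> max 0 (Linf_norm \<Omega> V)"
proof -
  let ?e = "esssup (lebesgue_on \<Omega>) (\<lambda>x. ereal \<bar>V x\<bar>)"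
  show "(\<lambda>x. indicator \<Omega> x * V x) \<in> borel_measurable lebesgue"
    using assms borel_measurable_restrict_space_iff[of \<Omega> lebesgue V]
    by (simp add: Linf_on_def mult.commute)
  have "AE x in lebesgue_on \<Omega>. ereal \<bar>V x\<bar> \<le> ?e"
    by (rule esssup_AE)
  then have "AE x in lebesgue_on \<Omega>. \<bar>V x\<bar> \<le> Linf_norm \<Omega> V"
  proof eventually_elim
    fix x assume "ereal \<bar>V x\<bar> \<le> ?e"
    moreover have "?e < \<infinity>" using assms(2) by (simp add: Linf_on_def)
    ultimately show "\<bar>V x\<bar> \<le> Linf_norm \<Omega> V"
      unfolding Linf_norm_def by (cases ?e) auto
  qed
  then have "AE x in lebesgue. x \<in> \<Omega> \<longrightarrow> \<bar>V x\<bar> \<le> Linf_norm \<Omega> V"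
    using assms(1) by (simp add: AE_restrict_space_iff)
  then show "AE x in lebesgue. \<bar>indicator \<Omega> x * V x\<bar> \<le> max 0 (Linf_norm \<Omega> V)"
    by eventually_elim (auto simp: indicator_def)
qed

lemma test_fun_partial:
  assumes "test_fun \<Omega> \<phi>" "i \<in> Basis"
  shows "test_fun \<Omega> (partial i \<phi>)"
proof -
  let ?K = "closure {x. \<phi> x \<noteq> 0}"
  have zero: "partial i \<phi> x = 0" if "x \<notin> ?K" for x
  proof -
    have "((\<lambda>x. 0) has_derivative (\<lambda>x. 0)) (at x)" by simp
    then have "(\<phi> has_derivative (\<lambda>x. 0)) (at x)"
    proof (rule has_derivative_transform_within_open[where s = "- ?K"])
      fix z assume "z \<in> - ?K"
      then show "0 = \<phi> z" using closure_subset[of "{x. \<phi> x \<noteq> 0}"] by auto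
    qed (use that in auto)
    then have "frechet_derivative \<phi> (at x) = (\<lambda>x. 0)"
      by (rule frechet_derivative_at[symmetric])
    then show ?thesis by (simp add: partial_def)
  qed
  have sub: "closure {x. partial i \<phi> x \<noteq> 0} \<subseteq> ?K"
    by (rule closure_minimal) (use zero in auto)
  have "Ck k (partial i \<phi>)" for k
    using assms by (auto simp: test_fun_def dest: spec[of _ "Suc k"])
  moreover have "compact (closure {x. partial i \<phi> x \<noteq> 0})"
    using assms(1) compact_Int_closed[of ?K "closure {x. partial i \<phi> x \<noteq> 0}"] sub
    by (simp add: test_fun_def Int_absorb1)
  ultimately show ?thesis
    using assms(1) sub by (auto simp: test_fun_def)
qed

text \<open>Integration by parts along the approximating test functions. Weak
  derivatives of the same function have the same pairings with test functions; no more is needed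
  to identify them, because the partial derivatives of the approximating functions are test
  functions themselves.\<close>

lemma inner_weak_laplacian_nonpos:
  assumes u: "u \<in> H10 \<Omega>" and w: "weak_laplacian \<Omega> u w"
  shows "w \<bullet> u \<le> 0"
proof -
  from w obtain g h where gh: "\<And>i. i \<in> Basis \<Longrightarrow> weak_partial \<Omega> i u (g i)"
      "\<And>i. i \<in> Basis \<Longrightarrow> weak_partial \<Omega> i (g i) (h i)" and w_eq: "w = (\<Sum>i\<in>Basis. h i)"
    unfolding weak_laplacian_def by blast
  from u obtain \<phi> where test: "\<And>n. test_fun \<Omega> (\<phi> n)" and lim: "(\<lambda>n. abs_L2 (\<phi> n)) \<longlonglongrightarrow> u"
    and ex: "\<And>i. i \<in> Basis \<Longrightarrow> \<exists>g. weak_partial \<Omega> i u g \<and> (\<lambda>n. abs_L2 (partial i (\<phi> n))) \<longlonglongrightarrow> g"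
    unfolding H10_def by blast
  have "h i \<bullet> u \<le> 0" if i: "i \<in> Basis" for i
  proof -
    from ex[OF i] obtain g' where g': "weak_partial \<Omega> i u g'"
      and lim': "(\<lambda>n. abs_L2 (partial i (\<phi> n))) \<longlonglongrightarrow> g'" by blast
    have "(\<lambda>n. h i \<bullet> abs_L2 (\<phi> n)) \<longlonglongrightarrow> h i \<bullet> u"
      by (intro tendsto_inner tendsto_const lim)
    moreover have "h i \<bullet> abs_L2 (\<phi> n) = - (g i \<bullet> abs_L2 (partial i (\<phi> n)))" for n
      using gh(2)[OF i] test[of n] unfolding weak_partial_def by auto
    moreover have "g i \<bullet> abs_L2 (partial i (\<phi> n)) = g' \<bullet> abs_L2 (partial i (\<phi> n))" for n
    proof -
      have t: "test_fun \<Omega> (partial i (\<phi> n))" by (rule test_fun_partial[OF test i])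
      have "u \<bullet> abs_L2 (partial i (partial i (\<phi> n))) = - (g i \<bullet> abs_L2 (partial i (\<phi> n)))"
        "u \<bullet> abs_L2 (partial i (partial i (\<phi> n))) = - (g' \<bullet> abs_L2 (partial i (\<phi> n)))"
        using t gh(1)[OF i] g' unfolding weak_partial_def by auto
      then show ?thesis by simp
    qed
    moreover have "(\<lambda>n. - (g' \<bullet> abs_L2 (partial i (\<phi> n)))) \<longlonglongrightarrow> - (g' \<bullet> g')"
      by (intro tendsto_minus tendsto_inner tendsto_const lim')
    ultimately have "h i \<bullet> u = - (g' \<bullet> g')"
      by (simp add: LIMSEQ_unique)
    then show ?thesis by simp
  qed
  then show ?thesis
    unfolding w_eq inner_sum_left by (intro sum_nonpos) auto
qed

text \<open>Pairing the eigenvalue equation with \<open>u\<close> leaves only the potential, since the Laplacian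
  contributes with the right sign.\<close>

lemma eigenvalue_lower_bound:
  assumes "\<Omega> \<in> sets lebesgue" "V \<in> Linf_on \<Omega>"
    and eig: "(u, - l *\<^sub>R u) \<in> schroedinger_op \<Omega> V" and u: "norm u = 1"
  shows "- max 0 (Linf_norm \<Omega> V) \<le> l"
proof -
  let ?Q = "mult_L2 (\<lambda>x. indicator \<Omega> x * V x) u"
  from eig obtain w where w: "- l *\<^sub>R u = w - ?Q" "u \<in> H10 \<Omega>" "weak_laplacian \<Omega> u w"
    unfolding schroedinger_op_def by auto
  have "- l = (- l *\<^sub>R u) \<bullet> u" using u by (simp add: dot_square_norm)
  also have "\<dots> = w \<bullet> u - ?Q \<bullet> u" by (simp only: w(1) inner_diff_left)
  finally show ?thesis
    using inner_weak_laplacian_nonpos[OF w(2,3)]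
      abs_inner_mult_L2_le[OF AE_Linf_norm[OF assms(1,2)], of u] u by simp
qed


section \<open>Local boundedness of semigroups and their eigenvectors\<close>

text \<open>By Baire's theorem one of the closed sets of points \<open>u\<close> with \<open>norm (L n u) \<le> k\<close> for all \<open>n\<close> has an
  interior point relative to \<open>X\<close>; translating it to \<open>0\<close> and scaling gives the bound.\<close>

lemma uniform_boundedness_on_closed_subspace:
  fixes L :: "nat \<Rightarrow> 'b::banach \<Rightarrow> 'c::real_normed_vector"
  assumes X: "closed X" "subspace X"
    and add: "\<And>n u v. u \<in> X \<Longrightarrow> v \<in> X \<Longrightarrow> L n (u + v) = L n u + L n v"
    and scale: "\<And>n c u. u \<in> X \<Longrightarrow> L n (c *\<^sub>R u) = c *\<^sub>R L n u"
    and bounded: "\<And>n. \<exists>K. \<forall>u\<in>X. norm (L n u) \<le> K * norm u"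
    and pointwise: "\<And>u. u \<in> X \<Longrightarrow> \<exists>B. \<forall>n. norm (L n u) \<le> B"
  shows "\<exists>B. \<forall>n. \<forall>u\<in>X. norm (L n u) \<le> B * norm u"
proof -
  have diff: "L n (u - v) = L n u - L n v" if "u \<in> X" "v \<in> X" for n u v
    using add[of u "- v" n] scale[of v n "-1"] that X(2) by (simp add: subspace_neg)
  have cont: "continuous_on X (L n)" for n
  proof -
    obtain K where K: "\<forall>u\<in>X. norm (L n u) \<le> K * norm u" using bounded by blast
    have "norm (L n u) \<le> \<bar>K\<bar> * norm u" if "u \<in> X" for u
      using K that mult_right_mono[of K "\<bar>K\<bar>" "norm u"] by (auto intro: order_trans)
    then have "\<bar>K\<bar>-lipschitz_on X (L n)"
      by (intro lipschitz_onI)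
         (use diff X(2) in \<open>simp_all add: dist_norm subspace_diff flip: diff\<close>)
    then show ?thesis by (rule lipschitz_on_continuous_on)
  qed
  define A where "A k = (\<Inter>n. {u \<in> X. norm (L n u) \<le> real k})" for k
  have closed: "closedin (top_of_set X) (A k)" for k
    unfolding A_def
  proof (intro closedin_Inter)
    fix T assume "T \<in> range (\<lambda>n. {u \<in> X. norm (L n u) \<le> real k})"
    then obtain n where "T = X \<inter> (\<lambda>u. norm (L n u)) -` {..real k}" by auto
    then show "closedin (top_of_set X) T"
      using continuous_closedin_preimage[OF continuous_on_norm[OF cont] closed_atMost] by auto
  qed auto
  have "\<Union> (range A) = X"
  proof
    show "X \<subseteq> \<Union> (range A)"
    proof
      fix u assume u: "u \<in> X"
      then obtain B where B: "\<forall>n. norm (L n u) \<le> B" using pointwise by blast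
      obtain k :: nat where "B \<le> real k" using real_arch_simple by blast
      then have "u \<in> A k" using u B by (auto simp: A_def intro: order_trans)
      then show "u \<in> \<Union> (range A)" by blast
    qed
  qed (auto simp: A_def)
  moreover have "(0::'b) \<in> X" using X(2) by (rule subspace_0)
  ultimately have "top_of_set X interior_of \<Union> (range A) \<noteq> {}"
    using interior_of_topspace[of "top_of_set X"] by auto
  moreover have "completely_metrizable_space (top_of_set X)"
    using completely_metrizable_space_closedin[OF completely_metrizable_space_euclidean] X(1) by simp
  ultimately obtain k where "top_of_set X interior_of A k \<noteq> {}"
    using Baire_category_alt[of "top_of_set X" "range A"] closed by auto
  then obtain u0 U where U: "openin (top_of_set X) U" "u0 \<in> U" "U \<subseteq> A k"
    by (auto simp: interior_of_def)
  then obtain e where e: "e > 0" "ball u0 e \<inter> X \<subseteq> U"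
    by (auto simp: openin_contains_ball)
  have u0: "u0 \<in> X" using U by (auto simp: A_def)
  have "norm (L n u) \<le> (4 * real k / e) * norm u" if u: "u \<in> X" for n u
  proof (cases "u = 0")
    case True
    then show ?thesis using scale[of 0 n 0] X(2) by (simp add: subspace_0)
  next
    case False
    define r where "r = e / (2 * norm u)"
    have r: "r > 0" using False e by (simp add: r_def)
    have ru: "r *\<^sub>R u \<in> X" by (intro subspace_scale X u)
    have "norm (r *\<^sub>R u) < e" using False e by (simp add: r_def)
    then have "u0 + r *\<^sub>R u \<in> ball u0 e" by (simp add: dist_norm)
    then have "u0 + r *\<^sub>R u \<in> A k"
      using e(2) U(3) subspace_add[OF X(2) u0 ru] by blast
    moreover have "u0 \<in> A k" using U by auto
    ultimately have *: "norm (L n (u0 + r *\<^sub>R u)) \<le> k" "norm (L n u0) \<le> k"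
      by (auto simp: A_def)
    have "r * norm (L n u) = norm (L n (u0 + r *\<^sub>R u) - L n u0)"
      using r by (simp add: add[OF u0 ru] scale[OF u])
    also have "\<dots> \<le> 2 * real k"
      using norm_triangle_ineq4[of "L n (u0 + r *\<^sub>R u)" "L n u0"] * by linarith
    finally have "norm (L n u) \<le> 2 * real k / r"
      using r by (simp add: field_simps)
    then show ?thesis using False e by (simp add: r_def field_simps)
  qed
  then show ?thesis by blast
qed

text \<open>Otherwise there are times \<open>t n \<rightarrow> 0\<close> with operator norms above \<open>n\<close>, although \<open>S (t n) u\<close> converges for
  each \<open>u\<close>; this contradicts uniform boundedness.\<close>

lemma C0_semigroup_locally_bounded:
  fixes X :: "'b::banach set"
  assumes X: "closed X" "subspace X" and S: "C0_semigroup_on X S"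
  shows "\<exists>\<delta>>0. \<exists>K. \<forall>t\<in>{0..\<delta>}. \<forall>u\<in>X. norm (S t u) \<le> K * norm u"
proof (rule ccontr)
  assume contra: "\<not> ?thesis"
  have "\<exists>t u. t \<in> {0..1 / real (Suc n)} \<and> u \<in> X \<and> norm (S t u) > real n * norm u" for n
  proof -
    have "1 / real (Suc n) > 0" by simp
    then have "\<not> (\<forall>t\<in>{0..1 / real (Suc n)}. \<forall>u\<in>X. norm (S t u) \<le> real n * norm u)"
      using contra by blast
    then show ?thesis by (meson not_le)
  qed
  then obtain t u where t: "\<And>n. t n \<in> {0..1 / real (Suc n)}"
    and u: "\<And>n. u n \<in> X" "\<And>n. norm (S (t n) (u n)) > real n * norm (u n)" by metis
  have t0: "t n \<ge> 0" for n using t by auto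
  have "\<exists>B. \<forall>n. \<forall>u\<in>X. norm (S (t n) u) \<le> B * norm u"
  proof (rule uniform_boundedness_on_closed_subspace[OF X])
    fix v assume v: "v \<in> X"
    have "((\<lambda>t. S t v) \<longlongrightarrow> v) (at_right 0)"
      using S v by (auto simp: C0_semigroup_on_def)
    then have "eventually (\<lambda>t. dist (S t v) v < 1) (at_right 0)"
      by (auto simp: tendsto_iff)
    then obtain d where d: "d > 0" "\<And>t. 0 < t \<Longrightarrow> t < d \<Longrightarrow> dist (S t v) v < 1"
      unfolding eventually_at_right[OF zero_less_one] by auto
    have near: "norm (S t v) \<le> norm v + 1" if "0 \<le> t" "t < d" for t
    proof (cases "t = 0")
      case True
      then show ?thesis using S v by (simp add: C0_semigroup_on_def)
    next
      case False
      then have "dist (S t v) v < 1" using d that by simp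
      then show ?thesis using norm_triangle_ineq2[of "S t v" v] by (simp add: dist_norm)
    qed
    obtain n0 where n0: "1 / real (Suc n0) < d" using d(1) nat_approx_posE by blast
    have "norm (S (t n) v) \<le> norm v + 1 + (\<Sum>i<n0. norm (S (t i) v))" for n
    proof (cases "n < n0")
      case True
      then show ?thesis
        using member_le_sum[of n "{..<n0}" "\<lambda>i. norm (S (t i) v)"] by (simp add: add_increasing)
    next
      case False
      then have "1 / real (Suc n) \<le> 1 / real (Suc n0)" by (intro divide_left_mono) auto
      then have "t n < d" using t[of n] n0 by auto
      then have "norm (S (t n) v) \<le> norm v + 1" using near t0 by blast
      then show ?thesis by (meson add_increasing2 norm_ge_zero order_trans sum_nonneg order_refl)
    qed
    then show "\<exists>B. \<forall>n. norm (S (t n) v) \<le> B" by blast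
  qed (use S t0 in \<open>auto simp: C0_semigroup_on_def\<close>)
  then obtain B where B: "\<And>n v. v \<in> X \<Longrightarrow> norm (S (t n) v) \<le> B * norm v" by blast
  obtain n :: nat where "B \<le> real n" using real_arch_simple by blast
  then have "B * norm (u n) \<le> real n * norm (u n)" by (intro mult_right_mono) auto
  then show False using B[where n = n, OF u(1)[of n]] u(2)[of n] by linarith
qed

lemma C0_semigroup_multiple:
  assumes S: "C0_semigroup_on X S" and u: "u \<in> X" and t: "t \<ge> 0" and eig: "S t u = q *\<^sub>R u"
  shows "S (real k * t) u = q ^ k *\<^sub>R u"
proof (induction k)
  case 0
  then show ?case using S u by (simp add: C0_semigroup_on_def)
next
  case (Suc k)
  have "S (real (Suc k) * t) u = S (real k * t) (S t u)"
    using S u t by (simp add: C0_semigroup_on_def distrib_right add.commute[of t])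
  also have "\<dots> = q *\<^sub>R S (real k * t) u"
    using S u t by (simp add: C0_semigroup_on_def eig)
  finally show ?case using Suc by simp
qed

text \<open>The generator only controls the right derivative at \<open>0\<close>. Comparing the orbit with its
  expected value after \<open>n\<close> steps of length \<open>t / n\<close>, the errors of the single steps are \<open>o(t / n)\<close>
  and are propagated by operators that are bounded uniformly on short time intervals.\<close>

lemma semigroup_eigenvector:
  fixes X :: "'b::banach set"
  assumes X: "closed X" "subspace X" and S: "C0_semigroup_on X S"
    and gen: "(u, l *\<^sub>R u) \<in> generator_on X S" and t: "t \<ge> 0"
  shows "S t u = exp (l * t) *\<^sub>R u"
proof -
  have u: "u \<in> X" and der: "((\<lambda>t. (S t u - u) /\<^sub>R t) \<longlongrightarrow> l *\<^sub>R u) (at_right 0)"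
    using gen by (auto simp: generator_on_def)
  obtain \<delta> K0 where \<delta>: "\<delta> > 0"
    and K0: "\<And>t u. t \<in> {0..\<delta>} \<Longrightarrow> u \<in> X \<Longrightarrow> norm (S t u) \<le> K0 * norm u"
    using C0_semigroup_locally_bounded[OF X S] by blast
  define K where "K = \<bar>K0\<bar>"
  have K: "norm (S t v) \<le> K * norm v" if "t \<in> {0..\<delta>}" "v \<in> X" for t v
    unfolding K_def by (rule order_trans[OF K0[OF that] mult_right_mono]) auto
  have K_nonneg: "K \<ge> 0" by (simp add: K_def)
  have step_error: "((\<lambda>r. norm ((S r u - exp (l * r) *\<^sub>R u) /\<^sub>R r)) \<longlongrightarrow> 0) (at_right 0)"
  proof -
    have "((\<lambda>r. exp (l * r)) has_real_derivative l) (at 0)"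
      by (auto intro!: derivative_eq_intros)
    then have "((\<lambda>r. (exp (l * r) - 1) / r) \<longlongrightarrow> l) (at_right 0)"
      by (auto simp: has_field_derivative_iff intro: tendsto_within_subset)
    then have "((\<lambda>r. (S r u - u) /\<^sub>R r - ((exp (l * r) - 1) / r) *\<^sub>R u) \<longlongrightarrow> l *\<^sub>R u - l *\<^sub>R u)
        (at_right 0)"
      by (intro tendsto_intros der)
    then have "((\<lambda>r. (S r u - exp (l * r) *\<^sub>R u) /\<^sub>R r) \<longlongrightarrow> 0) (at_right 0)"
      by (simp add: algebra_simps divide_inverse)
    then show ?thesis by (rule tendsto_norm_zero)
  qed
  have short: "S t u = exp (l * t) *\<^sub>R u" if t: "0 < t" "t \<le> \<delta>" for t
  proof -
    \<comment> \<open>The error of one step of length \<open>t / Suc n\<close>.\<close>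
    define e where "e n = norm (S (t / real (Suc n)) u - exp (l * (t / real (Suc n))) *\<^sub>R u)" for n
    have bound: "norm (S t u - exp (l * t) *\<^sub>R u) \<le> real (Suc n) * (K * exp (\<bar>l\<bar> * t) * e n)" for n
    proof -
      define \<tau> where "\<tau> = t / real (Suc n)"
      define q where "q = exp (l * \<tau>)"
      define Q where "Q = exp (\<bar>l\<bar> * \<tau>)"
      have \<tau>: "\<tau> > 0" using t by (simp add: \<tau>_def)
      have "norm (S (real k * \<tau>) u - q ^ k *\<^sub>R u) \<le> real k * (K * Q ^ k * e n)" if "k \<le> Suc n" for k
        using that
      proof (induction k)
        case 0
        then show ?case using S u by (simp add: C0_semigroup_on_def)
      next
        case (Suc k)
        have "real k * \<tau> \<le> real (Suc n) * \<tau>"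
          using Suc.prems \<tau> by (intro mult_right_mono) auto
        then have k\<tau>: "real k * \<tau> \<in> {0..\<delta>}"
          using t \<tau> by (simp add: \<tau>_def)
        have \<tau>u: "S \<tau> u \<in> X" using S u \<tau> by (simp add: C0_semigroup_on_def)
        have qu: "q *\<^sub>R u \<in> X" by (intro subspace_scale X u)
        have "S (real (Suc k) * \<tau>) u = S (real k * \<tau>) (S \<tau> u)"
          using S u \<tau> by (simp add: C0_semigroup_on_def distrib_right add.commute[of \<tau>])
        also have "\<dots> = S (real k * \<tau>) ((S \<tau> u - q *\<^sub>R u) + q *\<^sub>R u)" by simp
        also have "\<dots> = S (real k * \<tau>) (S \<tau> u - q *\<^sub>R u) + S (real k * \<tau>) (q *\<^sub>R u)"
          using S k\<tau> qu subspace_diff[OF X(2) \<tau>u qu]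
          unfolding C0_semigroup_on_def atLeastAtMost_iff by blast
        also have "S (real k * \<tau>) (q *\<^sub>R u) = q *\<^sub>R S (real k * \<tau>) u"
          using S u k\<tau> by (simp add: C0_semigroup_on_def)
        finally have "norm (S (real (Suc k) * \<tau>) u - q ^ Suc k *\<^sub>R u)
            = norm (S (real k * \<tau>) (S \<tau> u - q *\<^sub>R u) + q *\<^sub>R (S (real k * \<tau>) u - q ^ k *\<^sub>R u))"
          by (simp add: algebra_simps)
        also have "\<dots> \<le> K * e n + q * (real k * (K * Q ^ k * e n))"
        proof (rule norm_triangle_mono)
          show "norm (S (real k * \<tau>) (S \<tau> u - q *\<^sub>R u)) \<le> K * e n"
            using K[OF k\<tau> subspace_diff[OF X(2) \<tau>u qu]] by (simp add: e_def q_def \<tau>_def)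
          show "norm (q *\<^sub>R (S (real k * \<tau>) u - q ^ k *\<^sub>R u)) \<le> q * (real k * (K * Q ^ k * e n))"
            using Suc by (simp add: q_def)
        qed
        also have "\<dots> \<le> Q ^ Suc k * (K * e n) + Q * (real k * (K * Q ^ k * e n))"
        proof (rule add_mono)
          have "1 \<le> Q" using \<tau> by (simp add: Q_def)
          then have "1 \<le> Q ^ Suc k" by (rule one_le_power)
          then have "1 * (K * e n) \<le> Q ^ Suc k * (K * e n)"
            by (rule mult_right_mono) (simp add: K_nonneg e_def)
          then show "K * e n \<le> Q ^ Suc k * (K * e n)" by simp
          have "q \<le> Q" using \<tau> by (simp add: q_def Q_def mult_right_mono)
          then show "q * (real k * (K * Q ^ k * e n)) \<le> Q * (real k * (K * Q ^ k * e n))"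
            by (rule mult_right_mono) (simp add: K_nonneg e_def Q_def)
        qed
        also have "\<dots> = real (Suc k) * (K * Q ^ Suc k * e n)" by (simp add: algebra_simps)
        finally show ?case .
      qed
      from this[of "Suc n"] have "norm (S (real (Suc n) * \<tau>) u - q ^ Suc n *\<^sub>R u)
          \<le> real (Suc n) * (K * Q ^ Suc n * e n)" by simp
      moreover have "real (Suc n) * \<tau> = t" by (simp add: \<tau>_def)
      moreover have "q ^ Suc n = exp (l * t)" "Q ^ Suc n = exp (\<bar>l\<bar> * t)"
        unfolding q_def Q_def exp_of_nat_mult[symmetric] by (simp_all add: \<tau>_def)
      ultimately show ?thesis by simp
    qed
    have "filterlim (\<lambda>n. t / real (Suc n)) (at_right 0) sequentially"
      unfolding filterlim_at
      using t LIMSEQ_Suc[OF lim_const_over_n[of t]] by simp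
    from filterlim_compose[OF step_error this]
    have "(\<lambda>n. e n / (t / real (Suc n))) \<longlonglongrightarrow> 0"
      using t by (simp add: e_def divide_inverse mult.commute)
    then have lim: "(\<lambda>n. (t * (K * exp (\<bar>l\<bar> * t))) * (e n / (t / real (Suc n)))) \<longlonglongrightarrow> 0"
      by (rule tendsto_mult_right_zero)
    have le: "norm (S t u - exp (l * t) *\<^sub>R u)
        \<le> (t * (K * exp (\<bar>l\<bar> * t))) * (e n / (t / real (Suc n)))" for n
    proof -
      have "(t * (K * exp (\<bar>l\<bar> * t))) * (e n / (t / real (Suc n)))
          = real (Suc n) * (K * exp (\<bar>l\<bar> * t) * e n)"
        using t by (simp add: field_simps)
      then show ?thesis using bound[of n] by (simp only:)
    qed
    have "norm (S t u - exp (l * t) *\<^sub>R u) \<le> 0"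
      by (rule LIMSEQ_le_const[OF lim]) (use le in blast)
    then show ?thesis by simp
  qed
  show ?thesis
  proof (cases "t = 0")
    case True
    then show ?thesis using S u by (simp add: C0_semigroup_on_def)
  next
    case False
    obtain n :: nat where n: "t / \<delta> \<le> real n" using real_arch_simple by blast
    have tn: "0 < t / real (Suc n)" "t / real (Suc n) \<le> \<delta>"
      using False t n \<delta> by (auto simp: field_simps intro: order_trans)
    have "S (real (Suc n) * (t / real (Suc n))) u = exp (l * (t / real (Suc n))) ^ Suc n *\<^sub>R u"
      by (rule C0_semigroup_multiple[OF S u _ short[OF tn]]) (use t in simp)
    then show ?thesis
      unfolding exp_of_nat_mult[symmetric] by simp
  qed
qed


section \<open>The exponential above its tangent line\<close>

text \<open>The integrand lies above its tangent at the midpoint \<open>b / 2\<close>, and the linear part of the tangent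
  integrates to \<open>0\<close>.\<close>

lemma exp_integral_ge_midpoint:
  "b * exp (- l * (b / 2)) \<le> integral {0..b} (\<lambda>s. exp (- l * (b - s)))" if b: "0 \<le> b" for b l :: real
proof -
  let ?G = "\<lambda>s. exp (- l * (b / 2)) * (s + l * (s\<^sup>2 / 2 - b / 2 * s))"
  have "((\<lambda>s. exp (- l * (b / 2)) * (1 + l * (s - b / 2))) has_integral ?G b - ?G 0) {0..b}"
    by (rule fundamental_theorem_of_calculus[OF b])
       (auto intro!: derivative_eq_intros simp flip: has_real_derivative_iff_has_vector_derivative)
  then have tangent: "((\<lambda>s. exp (- l * (b / 2)) * (1 + l * (s - b / 2)))
      has_integral b * exp (- l * (b / 2))) {0..b}"
    by (simp add: power2_eq_square mult.commute[of b "exp _"])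
  show ?thesis
  proof (rule has_integral_le[OF tangent])
    show "((\<lambda>s. exp (- l * (b - s))) has_integral integral {0..b} (\<lambda>s. exp (- l * (b - s)))) {0..b}"
      by (intro integrable_integral integrable_continuous_interval continuous_intros)
    fix s assume "s \<in> {0..b}"
    have "exp (- l * (b / 2)) * (1 + l * (s - b / 2)) \<le> exp (- l * (b / 2)) * exp (l * (s - b / 2))"
      by (intro mult_left_mono exp_ge_add_one_self) auto
    also have "\<dots> = exp (- l * (b - s))"
      by (simp add: algebra_simps flip: exp_add)
    finally show "exp (- l * (b / 2)) * (1 + l * (s - b / 2)) \<le> exp (- l * (b - s))" .
  qed
qed


section \<open>Diagonal semigroups\<close>

text \<open>The projection \<open>P\<close> onto \<open>X\<close> turns the operators \<open>S t\<close>, which are specified on \<open>X\<close> only, into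
  bounded operators \<open>S t \<circ> P\<close> of the whole space, to which the calculus of limits and integrals
  applies.\<close>

locale diagonal_semigroup =
  fixes X :: "'b::{real_inner,banach} set" and P :: "'b \<Rightarrow> 'b" and S :: "real \<Rightarrow> 'b \<Rightarrow> 'b"
    and lam :: "nat \<Rightarrow> real" and \<xi> :: "nat \<Rightarrow> 'b" and g :: real
  assumes bounded_linear_P: "bounded_linear P"
    and P_in: "P u \<in> X"
    and P_id: "u \<in> X \<Longrightarrow> P u = u"
    and semigroup: "C0_semigroup_on X S"
    and eigenvector: "1 \<le> j \<Longrightarrow> 0 \<le> t \<Longrightarrow> S t (\<xi> j) = exp (- lam j * t) *\<^sub>R \<xi> j"
    and orthonormal: "1 \<le> i \<Longrightarrow> 1 \<le> j \<Longrightarrow> \<xi> i \<bullet> \<xi> j = (if i = j then 1 else 0)"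
    and dense: "closure (span (\<xi> ` {1..})) = X"
    and lower: "1 \<le> j \<Longrightarrow> - g \<le> lam j"
    and g_nonneg: "0 \<le> g"
begin

lemma X_iff: "u \<in> X \<longleftrightarrow> P u = u"
  using P_in P_id by metis

lemma subspace_X: "subspace X"
proof -
  interpret bounded_linear P by (rule bounded_linear_P)
  show ?thesis by (auto simp: subspace_def X_iff add zero scaleR)
qed

lemma xi_in: "1 \<le> j \<Longrightarrow> \<xi> j \<in> X"
  using dense closure_subset span_superset by (metis atLeast_iff image_eqI subsetD)

lemma norm_xi: "1 \<le> j \<Longrightarrow> norm (\<xi> j) = 1"
  by (simp add: norm_eq_1 orthonormal)

lemma S_in: "0 \<le> t \<Longrightarrow> u \<in> X \<Longrightarrow> S t u \<in> X"
  using semigroup by (auto simp: C0_semigroup_on_def)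

lemma S_zero: "u \<in> X \<Longrightarrow> S 0 u = u"
  using semigroup by (auto simp: C0_semigroup_on_def)

lemma S_comp: "0 \<le> s \<Longrightarrow> 0 \<le> t \<Longrightarrow> u \<in> X \<Longrightarrow> S s (S t u) = S (s + t) u"
  using semigroup by (auto simp: C0_semigroup_on_def)

lemma S_add: "0 \<le> t \<Longrightarrow> u \<in> X \<Longrightarrow> v \<in> X \<Longrightarrow> S t (u + v) = S t u + S t v"
  using semigroup by (auto simp: C0_semigroup_on_def)

lemma S_scale: "0 \<le> t \<Longrightarrow> u \<in> X \<Longrightarrow> S t (c *\<^sub>R u) = c *\<^sub>R S t u"
  using semigroup by (auto simp: C0_semigroup_on_def)

lemma bounded_linear_SP:
  assumes t: "0 \<le> t"
  shows "bounded_linear (\<lambda>u. S t (P u))"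
proof -
  interpret P: bounded_linear P by (rule bounded_linear_P)
  obtain K where K: "\<forall>u\<in>X. norm (S t u) \<le> K * norm u"
    using semigroup t by (auto simp: C0_semigroup_on_def)
  obtain B where B: "\<And>u. norm (P u) \<le> norm u * B" using P.bounded by blast
  show ?thesis
  proof (rule bounded_linear_intro)
    show "S t (P (u + v)) = S t (P u) + S t (P v)" for u v
      by (simp add: P.add S_add t P_in)
    show "S t (P (c *\<^sub>R u)) = c *\<^sub>R S t (P u)" for c u
      by (simp add: P.scaleR S_scale t P_in)
    show "norm (S t (P u)) \<le> norm u * (\<bar>K\<bar> * B)" for u
    proof -
      have "norm (S t (P u)) \<le> K * norm (P u)" using K P_in by blast
      also have "\<dots> \<le> \<bar>K\<bar> * (norm u * B)" by (intro mult_mono B) auto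
      finally show ?thesis by (simp add: algebra_simps)
    qed
  qed
qed

lemma S_diff: "0 \<le> t \<Longrightarrow> u \<in> X \<Longrightarrow> v \<in> X \<Longrightarrow> S t (u - v) = S t u - S t v"
  using linear_diff[OF bounded_linear.linear[OF bounded_linear_SP], of t u v]
  by (simp add: P_id subspace_diff[OF subspace_X])

lemma S_sum:
  assumes "0 \<le> t" "\<And>j. j \<in> J \<Longrightarrow> u j \<in> X"
  shows "S t (\<Sum>j\<in>J. u j) = (\<Sum>j\<in>J. S t (u j))"
  using linear_sum[OF bounded_linear.linear[OF bounded_linear_SP[OF assms(1)]], of u J] assms(2)
  by (simp add: P_id subspace_sum[OF subspace_X])


lemma S_combination:
  assumes "0 \<le> t" "\<And>j. j \<in> J \<Longrightarrow> u j \<in> X"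
  shows "S t (\<Sum>j\<in>J. c j *\<^sub>R u j) = (\<Sum>j\<in>J. c j *\<^sub>R S t (u j))"
  using assms by (simp add: S_sum S_scale subspace_scale[OF subspace_X])


section \<open>Expansion in eigenvectors\<close>

definition proj :: "nat \<Rightarrow> 'b \<Rightarrow> 'b" where
  "proj n u = (\<Sum>j=1..n. (u \<bullet> \<xi> j) *\<^sub>R \<xi> j)"

lemma bounded_linear_proj: "bounded_linear (proj n)"
  unfolding proj_def
  by (intro bounded_linear_sum bounded_linear_scaleR_left[THEN bounded_linear_compose]
      bounded_linear_inner_left)

lemma proj_in: "proj n u \<in> X"
  unfolding proj_def
  by (intro subspace_sum[OF subspace_X] subspace_scale[OF subspace_X] xi_in) auto

lemma inner_proj_left: "proj n u \<bullet> v = (\<Sum>j=1..n. (u \<bullet> \<xi> j) * (v \<bullet> \<xi> j))"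
  by (simp add: proj_def inner_sum_left inner_commute[of v])

lemma inner_proj_xi:
  assumes "1 \<le> i"
  shows "proj n u \<bullet> \<xi> i = (if i \<le> n then u \<bullet> \<xi> i else 0)"
proof -
  have "proj n u \<bullet> \<xi> i = (\<Sum>j=1..n. if i = j then u \<bullet> \<xi> j else 0)"
    unfolding inner_proj_left by (rule sum.cong) (use assms in \<open>auto simp: orthonormal\<close>)
  then show ?thesis using assms by simp
qed

lemma norm_proj_sq: "(norm (proj n u))\<^sup>2 = (\<Sum>j=1..n. (u \<bullet> \<xi> j)\<^sup>2)"
  unfolding power2_norm_eq_inner
  by (subst inner_proj_left, rule sum.cong) (auto simp: inner_proj_xi power2_eq_square)

lemma proj_xi: "1 \<le> j \<Longrightarrow> j \<le> n \<Longrightarrow> proj n (\<xi> j) = \<xi> j"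
proof -
  assume j: "1 \<le> j" "j \<le> n"
  have "proj n (\<xi> j) = (\<Sum>i=1..n. if i = j then \<xi> i else 0)"
    unfolding proj_def by (rule sum.cong) (use j in \<open>auto simp: orthonormal\<close>)
  then show ?thesis using j by simp
qed

text \<open>So \<open>proj n\<close> is the orthogonal projection onto the span of \<open>\<xi> 1, \<dots>, \<xi> n\<close>.\<close>

lemma inner_diff_proj:
  assumes "v \<in> span (\<xi> ` {1..n})"
  shows "(u - proj n u) \<bullet> v = 0"
  using assms
proof (induction rule: span_induct)
  case base
  show ?case by (auto simp: subspace_def inner_add_right)
next
  case (step v)
  then show ?case by (auto simp: inner_diff_left inner_proj_xi)
qed

lemma orth_proj_span: "orth_proj (span (\<xi> ` {1..n})) u = proj n u"
  unfolding orth_proj_def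
proof (rule the_equality)
  have in_span: "proj n u \<in> span (\<xi> ` {1..n})"
    unfolding proj_def by (intro span_sum span_scale span_base) auto
  then show "proj n u \<in> span (\<xi> ` {1..n}) \<and> (\<forall>v\<in>span (\<xi> ` {1..n}). (u - proj n u) \<bullet> v = 0)"
    using inner_diff_proj by blast
  fix p assume p: "p \<in> span (\<xi> ` {1..n}) \<and> (\<forall>v\<in>span (\<xi> ` {1..n}). (u - p) \<bullet> v = 0)"
  then have d: "p - proj n u \<in> span (\<xi> ` {1..n})" using in_span by (intro span_diff) auto
  have "(p - proj n u) \<bullet> (p - proj n u)
      = (u - proj n u) \<bullet> (p - proj n u) - (u - p) \<bullet> (p - proj n u)"
    by (simp add: inner_diff_left)
  also have "\<dots> = 0" using inner_diff_proj[OF d] p d by simp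
  finally show "p = proj n u" by simp
qed

lemma norm_diff_proj_le:
  assumes "v \<in> span (\<xi> ` {1..n})"
  shows "norm (u - proj n u) \<le> norm (u - v)"
proof -
  have "proj n u \<in> span (\<xi> ` {1..n})"
    unfolding proj_def by (intro span_sum span_scale span_base) auto
  then have "(u - proj n u) \<bullet> (proj n u - v) = 0"
    using assms by (intro inner_diff_proj span_diff)
  then have "(norm ((u - proj n u) + (proj n u - v)))\<^sup>2 = (norm (u - proj n u))\<^sup>2 + (norm (proj n u - v))\<^sup>2"
    by (intro norm_add_Pythagorean) (simp add: orthogonal_def)
  then have "(norm (u - proj n u))\<^sup>2 \<le> (norm (u - v))\<^sup>2" by simp
  then show ?thesis by (rule power2_le_imp_le) simp
qed

text \<open>\<open>proj n u\<close> is the best approximation of \<open>u\<close> from \<open>span (\<xi> ` {1..n})\<close>, and these spans exhaust a dense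
  subspace of \<open>X\<close>.\<close>

lemma proj_tendsto:
  assumes "u \<in> X"
  shows "(\<lambda>n. proj n u) \<longlonglongrightarrow> u"
proof (rule LIMSEQ_I)
  fix e :: real assume "e > 0"
  moreover have "u \<in> closure (span (\<xi> ` {1..}))" using assms dense by simp
  ultimately obtain v where v: "v \<in> span (\<xi> ` {1..})" "dist v u < e"
    unfolding closure_approachable by blast
  obtain B where B: "finite B" "B \<subseteq> \<xi> ` {1..}" "v \<in> span B"
  proof -
    obtain B c where "finite B" "B \<subseteq> \<xi> ` {1..}" "v = (\<Sum>b\<in>B. c b *\<^sub>R b)"
      using v(1) unfolding span_explicit by blast
    moreover from this(3) have "v \<in> span B" by (simp add: span_sum span_scale span_base)
    ultimately show ?thesis using that by blast
  qed
  then obtain J where J: "J \<subseteq> {1..}" "finite J" "B = \<xi> ` J"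
    by (meson finite_subset_image)
  have "norm (proj n u - u) < e" if n: "n \<ge> Max (insert 0 J)" for n
  proof -
    have "j \<le> n" if "j \<in> J" for j
      using n that J(2) by (meson Max_ge finite_insert insertI2 order_trans)
    then have "B \<subseteq> \<xi> ` {1..n}" using J by auto
    then have "v \<in> span (\<xi> ` {1..n})" using B(3) span_mono by blast
    then have "norm (u - proj n u) \<le> norm (u - v)" by (rule norm_diff_proj_le)
    then show ?thesis using v(2) by (simp add: dist_norm norm_minus_commute)
  qed
  then show "\<exists>n0. \<forall>n\<ge>n0. norm (proj n u - u) < e" by blast
qed

lemma parseval:
  assumes "u \<in> X"
  shows "(\<lambda>j. (u \<bullet> \<xi> (Suc j)) * (v \<bullet> \<xi> (Suc j))) sums (u \<bullet> v)"
proof -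
  have "(\<Sum>j<n. (u \<bullet> \<xi> (Suc j)) * (v \<bullet> \<xi> (Suc j))) = proj n u \<bullet> v" for n
    unfolding inner_proj_left
    by (rule sum.reindex_bij_witness[of _ "\<lambda>j. j - 1" Suc]) auto
  moreover have "(\<lambda>n. proj n u \<bullet> v) \<longlonglongrightarrow> u \<bullet> v"
    by (intro tendsto_inner proj_tendsto assms tendsto_const)
  ultimately show ?thesis by (simp add: sums_def)
qed

lemma norm_sq_sums:
  assumes "u \<in> X"
  shows "(\<lambda>j. (u \<bullet> \<xi> (Suc j))\<^sup>2) sums (norm u)\<^sup>2"
  using parseval[OF assms, of u] unfolding power2_norm_eq_inner by (simp add: power2_eq_square)

lemma norm_proj_le: "norm (proj n u) \<le> norm u"
proof -
  have "(norm (proj n u))\<^sup>2 = u \<bullet> proj n u"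
    unfolding norm_proj_sq by (subst inner_commute) (simp add: inner_proj_left power2_eq_square)
  also have "\<dots> \<le> norm u * norm (proj n u)" by (rule norm_cauchy_schwarz)
  finally show ?thesis by (cases "proj n u = 0") (auto simp: power2_eq_square)
qed

lemma norm_diff_proj_le_norm: "norm (u - proj n u) \<le> norm u"
  using norm_diff_proj_le[of 0 n u] by (simp add: span_zero)

lemma norm_xi_combination: "(norm (\<Sum>j=1..n. b j *\<^sub>R \<xi> j))\<^sup>2 = (\<Sum>j=1..n. (b j)\<^sup>2)"
proof -
  let ?w = "\<Sum>j=1..n. b j *\<^sub>R \<xi> j"
  have coeff: "?w \<bullet> \<xi> i = b i" if "i \<in> {1..n}" for i
  proof -
    have "?w \<bullet> \<xi> i = (\<Sum>j=1..n. if i = j then b j else 0)"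
      unfolding inner_sum_left by (rule sum.cong) (use that in \<open>auto simp: orthonormal\<close>)
    then show ?thesis using that by simp
  qed
  have "(norm ?w)\<^sup>2 = (\<Sum>j=1..n. b j * (?w \<bullet> \<xi> j))"
    unfolding power2_norm_eq_inner inner_sum_right by simp
  also have "\<dots> = (\<Sum>j=1..n. (b j)\<^sup>2)"
    by (rule sum.cong) (simp_all only: coeff power2_eq_square)
  finally show ?thesis .
qed

text \<open>Cauchy--Schwarz and Bessel: the coefficients are summed at the price of \<open>\<surd>n\<close>.\<close>

lemma sum_abs_coeff_le: "(\<Sum>j=1..n. \<bar>u \<bullet> \<xi> j\<bar>) \<le> sqrt (real n) * norm u"
proof (rule power2_le_imp_le)
  have "(\<Sum>j=1..n. \<bar>u \<bullet> \<xi> j\<bar>)\<^sup>2 \<le> real n * (\<Sum>j=1..n. (u \<bullet> \<xi> j)\<^sup>2)"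
    using Cauchy_Schwarz_ineq_sum[of "\<lambda>_. 1" "\<lambda>j. \<bar>u \<bullet> \<xi> j\<bar>" "{1..n}"] by simp
  also have "\<dots> \<le> real n * (norm u)\<^sup>2"
    unfolding norm_proj_sq[symmetric] by (intro mult_left_mono power_mono norm_proj_le) auto
  finally show "(\<Sum>j=1..n. \<bar>u \<bullet> \<xi> j\<bar>)\<^sup>2 \<le> (sqrt (real n) * norm u)\<^sup>2"
    by (simp add: power_mult_distrib)
qed simp


section \<open>The semigroup in coordinates\<close>

lemma exp_neg_lam_le: "1 \<le> j \<Longrightarrow> 0 \<le> t \<Longrightarrow> exp (- lam j * t) \<le> exp (g * t)"
  using lower[of j] mult_right_mono[of "- lam j" g t] by simp

lemma S_proj_eq:
  assumes "0 \<le> t"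
  shows "S t (proj n u) = (\<Sum>j=1..n. (exp (- lam j * t) * (u \<bullet> \<xi> j)) *\<^sub>R \<xi> j)"
proof -
  have "S t (proj n u) = (\<Sum>j=1..n. S t ((u \<bullet> \<xi> j) *\<^sub>R \<xi> j))"
    unfolding proj_def by (intro S_sum assms subspace_scale[OF subspace_X] xi_in) auto
  also have "\<dots> = (\<Sum>j=1..n. (exp (- lam j * t) * (u \<bullet> \<xi> j)) *\<^sub>R \<xi> j)"
    by (rule sum.cong) (auto simp: S_scale assms xi_in eigenvector mult.commute)
  finally show ?thesis .
qed

lemma coeff_S:
  assumes t: "0 \<le> t" and u: "u \<in> X" and i: "1 \<le> i"
  shows "S t u \<bullet> \<xi> i = exp (- lam i * t) * (u \<bullet> \<xi> i)"
proof -
  have "(\<lambda>n. S t (P (proj n u)) \<bullet> \<xi> i) \<longlonglongrightarrow> S t (P u) \<bullet> \<xi> i"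
    by (intro tendsto_inner tendsto_const bounded_linear.tendsto[OF bounded_linear_SP[OF t]]
        proj_tendsto u)
  moreover have "S t (P (proj n u)) \<bullet> \<xi> i = exp (- lam i * t) * (u \<bullet> \<xi> i)" if n: "n \<ge> i" for n
  proof -
    have "S t (P (proj n u)) \<bullet> \<xi> i = (\<Sum>j=1..n. if i = j then exp (- lam j * t) * (u \<bullet> \<xi> j) else 0)"
      unfolding P_id[OF proj_in] S_proj_eq[OF t] inner_sum_left
      by (rule sum.cong) (use i in \<open>auto simp: orthonormal\<close>)
    then show ?thesis using n i by simp
  qed
  then have "(\<lambda>n. S t (P (proj n u)) \<bullet> \<xi> i) \<longlonglongrightarrow> exp (- lam i * t) * (u \<bullet> \<xi> i)"
    by (intro tendsto_eventually) (auto simp: eventually_sequentially)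
  ultimately show ?thesis using LIMSEQ_unique by (metis P_id u)
qed

lemma S_proj: "0 \<le> t \<Longrightarrow> u \<in> X \<Longrightarrow> S t (proj n u) = proj n (S t u)"
  unfolding S_proj_eq unfolding proj_def by (rule sum.cong) (auto simp: coeff_S)

text \<open>This moves the free evolution between the observation and the initial state, and so turns the
  impulses \<open>h j\<close>, which act in one control problem, into weights for observing another trajectory.\<close>

lemma S_symmetric:
  assumes "0 \<le> t" "u \<in> X" "v \<in> X"
  shows "S t u \<bullet> v = u \<bullet> S t v"
proof -
  have "(\<lambda>j. (S t u \<bullet> \<xi> (Suc j)) * (v \<bullet> \<xi> (Suc j))) sums (S t u \<bullet> v)"
    by (rule parseval) (use assms S_in in auto)
  moreover have "(\<lambda>j. (u \<bullet> \<xi> (Suc j)) * (S t v \<bullet> \<xi> (Suc j))) sums (u \<bullet> S t v)"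
    by (rule parseval) (use assms in auto)
  ultimately show ?thesis
    using assms by (simp add: coeff_S mult_ac sums_unique2)
qed

text \<open>Compare the Parseval series of \<open>S t u\<close> and \<open>u\<close> term by term: only modes with factor at most
  \<open>exp (- \<mu> * t)\<close> are present.\<close>

lemma norm_S_le:
  assumes t: "0 \<le> t" and u: "u \<in> X" and low: "\<And>j. 1 \<le> j \<Longrightarrow> j \<le> n \<Longrightarrow> u \<bullet> \<xi> j = 0"
    and high: "\<And>j. n < j \<Longrightarrow> \<mu> \<le> lam j"
  shows "norm (S t u) \<le> exp (- \<mu> * t) * norm u"
proof (rule power2_le_imp_le)
  have "(norm (S t u))\<^sup>2 \<le> (exp (- \<mu> * t))\<^sup>2 * (norm u)\<^sup>2"
  proof (rule sums_le[OF _ norm_sq_sums[OF S_in[OF t u]] sums_mult[OF norm_sq_sums[OF u]]])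
    fix j
    show "(S t u \<bullet> \<xi> (Suc j))\<^sup>2 \<le> (exp (- \<mu> * t))\<^sup>2 * (u \<bullet> \<xi> (Suc j))\<^sup>2"
    proof (cases "Suc j \<le> n")
      case True
      then show ?thesis by (simp add: coeff_S t u low)
    next
      case False
      then have "exp (- lam (Suc j) * t) \<le> exp (- \<mu> * t)"
        using high[of "Suc j"] t by (simp add: mult_right_mono)
      then show ?thesis
        by (auto simp: coeff_S t u power_mult_distrib intro!: mult_right_mono power_mono)
    qed
  qed
  then show "(norm (S t u))\<^sup>2 \<le> (exp (- \<mu> * t) * norm u)\<^sup>2" by (simp add: power_mult_distrib)
qed simp

lemma norm_S_growth: "0 \<le> t \<Longrightarrow> u \<in> X \<Longrightarrow> norm (S t u) \<le> exp (g * t) * norm u"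
  using norm_S_le[of t u 0 "- g"] lower by simp

lemma norm_S_diff_proj:
  assumes t: "0 \<le> t" and u: "u \<in> X" and high: "\<And>j. n < j \<Longrightarrow> \<mu> \<le> lam j"
  shows "norm (S t (u - proj n u)) \<le> exp (- \<mu> * t) * norm (u - proj n u)"
  by (rule norm_S_le[where n = n])
     (use assms in \<open>auto simp: inner_diff_left inner_proj_xi subspace_diff[OF subspace_X] proj_in\<close>)

lemma norm_S_diff_proj_le_norm:
  assumes t: "0 \<le> t" and u: "u \<in> X" and high: "\<And>i. n < i \<Longrightarrow> 0 \<le> lam i"
  shows "norm (S t u - proj n (S t u)) \<le> norm u"
proof -
  have "S t u - proj n (S t u) = S t (u - proj n u)"
    using t u by (simp add: S_diff proj_in S_proj)
  then show ?thesis
    using norm_S_diff_proj[of t u n 0] t u high norm_diff_proj_le_norm[of u n] by simp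
qed

lemma norm_S_split:
  assumes t: "0 \<le> t" and u: "u \<in> X" and high: "\<And>j. n < j \<Longrightarrow> \<mu> \<le> lam j"
  shows "norm (S t u) \<le> exp (g * t) * norm (proj n u) + exp (- \<mu> * t) * norm (u - proj n u)"
proof -
  have "S t u = S t (proj n u + (u - proj n u))" by simp
  also have "\<dots> = S t (proj n u) + S t (u - proj n u)"
    by (intro S_add t proj_in subspace_diff[OF subspace_X] u)
  finally show ?thesis
    using norm_triangle_mono[OF norm_S_growth[OF t proj_in] norm_S_diff_proj[OF assms]] by simp
qed

text \<open>Right continuity at \<open>0\<close> is transported to every time by the semigroup law, in both directions, because
  the growth bound controls the operators uniformly on bounded intervals.\<close>

lemma continuous_on_S:
  assumes u: "u \<in> X"
  shows "continuous_on {0..} (\<lambda>t. S t u)"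
proof (rule continuous_onI)
  fix t e :: real assume t: "t \<in> {0..}" and e: "e > 0"
  define K where "K = exp (g * (t + 1))"
  have K: "K > 0" by (simp add: K_def)
  have "((\<lambda>t. S t u) \<longlongrightarrow> u) (at_right 0)"
    using semigroup u by (auto simp: C0_semigroup_on_def)
  then have "eventually (\<lambda>t. dist (S t u) u < e / K) (at_right 0)"
    using e K by (simp add: tendsto_iff)
  then obtain d where d: "d > 0" "\<And>r. 0 < r \<Longrightarrow> r < d \<Longrightarrow> dist (S r u) u < e / K"
    unfolding eventually_at_right[OF zero_less_one] by auto
  have close: "dist (S b u) (S a u) \<le> e" if "0 \<le> a" "a \<le> b" "b < a + d" "a \<le> t + 1" for a b
  proof (cases "a = b")
    case False
    have "S b u = S a (S (b - a) u)" using that u by (simp add: S_comp)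
    then have "S b u - S a u = S a (S (b - a) u - u)"
      using that u by (simp add: S_diff S_in)
    then have "dist (S b u) (S a u) \<le> exp (g * a) * dist (S (b - a) u) u"
      using norm_S_growth[of a "S (b - a) u - u"] that u
      by (simp add: dist_norm S_in subspace_diff[OF subspace_X])
    also have "\<dots> \<le> K * (e / K)"
    proof (rule mult_mono)
      show "exp (g * a) \<le> K" using that g_nonneg by (simp add: K_def mult_left_mono)
      show "dist (S (b - a) u) u \<le> e / K" using d(2)[of "b - a"] that False by simp
    qed (use K in auto)
    finally show ?thesis using K by simp
  qed (use e in simp)
  have "dist (S s u) (S t u) \<le> e" if "s \<in> {0..}" "dist s t < min d 1" for s
    using close[of t s] close[of s t] that t by (cases "s \<le> t") (auto simp: dist_real_def dist_commute)
  then show "\<exists>d>0. \<forall>s\<in>{0..}. dist s t < d \<longrightarrow> dist (S s u) (S t u) \<le> e"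
    using d(1) by (intro exI[of _ "min d 1"]) auto
qed

lemma continuous_on_S_reflect: "u \<in> X \<Longrightarrow> continuous_on {a..b} (\<lambda>s. S (b - s) u)"
  by (rule continuous_on_compose2[OF continuous_on_S]) (auto intro!: continuous_intros)


section \<open>The response to a constant force\<close>

text \<open>The state at time \<open>b\<close> that the force \<open>f\<close>, constant on \<open>[0, b]\<close>, produces from the initial state \<open>0\<close>.\<close>

definition response :: "real \<Rightarrow> 'b \<Rightarrow> 'b" where
  "response b f = integral {0..b} (\<lambda>s. S (b - s) f)"

lemma has_integral_response: "f \<in> X \<Longrightarrow> ((\<lambda>s. S (b - s) f) has_integral response b f) {0..b}"
  unfolding response_def
  by (intro integrable_integral integrable_continuous_interval continuous_on_S_reflect)

lemma integral_in_X:
  assumes "(f has_integral I) A" "\<And>s. s \<in> A \<Longrightarrow> f s \<in> X"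
  shows "I \<in> X"
proof -
  have "((P \<circ> f) has_integral P I) A"
    by (rule has_integral_linear[OF assms(1) bounded_linear_P])
  then have "(f has_integral P I) A"
    by (rule has_integral_eq[rotated]) (simp add: assms(2) P_id)
  then have "I = P I" by (rule has_integral_unique[OF assms(1)])
  then show ?thesis using P_in by metis
qed

lemma response_in: "f \<in> X \<Longrightarrow> response b f \<in> X"
  by (rule integral_in_X[OF has_integral_response]) (auto simp: S_in)

lemma response_sum:
  assumes "\<And>j. j \<in> J \<Longrightarrow> f j \<in> X" "finite J"
  shows "response b (\<Sum>j\<in>J. c j *\<^sub>R f j) = (\<Sum>j\<in>J. c j *\<^sub>R response b (f j))"
proof -
  have "((\<lambda>s. \<Sum>j\<in>J. c j *\<^sub>R S (b - s) (f j)) has_integral (\<Sum>j\<in>J. c j *\<^sub>R response b (f j))) {0..b}"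
    by (intro has_integral_sum has_integral_cmul has_integral_response assms)
  then have "((\<lambda>s. S (b - s) (\<Sum>j\<in>J. c j *\<^sub>R f j)) has_integral (\<Sum>j\<in>J. c j *\<^sub>R response b (f j))) {0..b}"
    by (rule has_integral_eq[rotated])
       (simp add: S_sum S_scale assms subspace_scale[OF subspace_X])
  then show ?thesis unfolding response_def by (rule integral_unique)
qed

lemma response_zero: "response b 0 = 0"
  using response_sum[of "{}" "\<lambda>_. 0" b "\<lambda>_. 0"] by simp

lemma coeff_response:
  assumes f: "f \<in> X" and i: "1 \<le> i"
  shows "response b f \<bullet> \<xi> i = integral {0..b} (\<lambda>s. exp (- lam i * (b - s))) * (f \<bullet> \<xi> i)"
proof -
  have "(((\<lambda>v. v \<bullet> \<xi> i) \<circ> (\<lambda>s. S (b - s) f)) has_integral response b f \<bullet> \<xi> i) {0..b}"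
    by (rule has_integral_linear[OF has_integral_response[OF f] bounded_linear_inner_left])
  then have "((\<lambda>s. exp (- lam i * (b - s)) * (f \<bullet> \<xi> i)) has_integral response b f \<bullet> \<xi> i) {0..b}"
    by (rule has_integral_eq[rotated]) (use f i in \<open>simp add: coeff_S\<close>)
  moreover have "((\<lambda>s. exp (- lam i * (b - s)) * (f \<bullet> \<xi> i)) has_integral
      integral {0..b} (\<lambda>s. exp (- lam i * (b - s))) * (f \<bullet> \<xi> i)) {0..b}"
    by (intro has_integral_mult_left integrable_integral integrable_continuous_interval
        continuous_intros)
  ultimately show ?thesis by (rule has_integral_unique)
qed

lemma norm_response_diff_proj:
  assumes b: "0 \<le> b" and f: "f \<in> X" and high: "\<And>j. n < j \<Longrightarrow> 0 \<le> lam j"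
  shows "norm (response b f - proj n (response b f)) \<le> b * norm f"
proof -
  let ?Q = "\<lambda>v. v - proj n v"
  have lin: "bounded_linear ?Q"
    by (intro bounded_linear_sub bounded_linear_ident bounded_linear_proj)
  have "((?Q \<circ> (\<lambda>s. S (b - s) f)) has_integral ?Q (response b f)) (cbox 0 b)"
    using has_integral_linear[OF has_integral_response[OF f] lin] by simp
  moreover have "norm ((?Q \<circ> (\<lambda>s. S (b - s) f)) s) \<le> norm f" if s: "s \<in> cbox 0 b" for s
  proof -
    have "?Q (S (b - s) f) = S (b - s) (?Q f)"
      using s f by (simp add: S_diff S_proj proj_in)
    then have "norm (?Q (S (b - s) f)) \<le> norm (?Q f)"
      using norm_S_diff_proj[of "b - s" f n 0] s f high by simp
    then show ?thesis using norm_diff_proj_le_norm[of f n] by simp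
  qed
  ultimately have "norm (?Q (response b f)) \<le> norm f * measure lborel (cbox 0 b)"
    by (intro has_integral_bound) auto
  then show ?thesis using b by (simp add: mult.commute)
qed


lemma norm_response_le:
  assumes b: "0 \<le> b" and f: "f \<in> X"
  shows "norm (response b f) \<le> b * exp (g * b) * norm f"
proof -
  have "norm (response b f) \<le> (exp (g * b) * norm f) * measure lborel (cbox 0 b)"
  proof (rule has_integral_bound)
    show "((\<lambda>s. S (b - s) f) has_integral response b f) (cbox 0 b)"
      using has_integral_response[OF f] by simp
    fix s assume s: "s \<in> cbox 0 b"
    then have "norm (S (b - s) f) \<le> exp (g * (b - s)) * norm f"
      using f by (intro norm_S_growth) auto
    also have "\<dots> \<le> exp (g * b) * norm f"
      using s g_nonneg by (intro mult_right_mono) (auto intro: mult_left_mono)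
    finally show "norm (S (b - s) f) \<le> exp (g * b) * norm f" .
  qed simp
  then show ?thesis using b by (simp add: mult_ac)
qed


section \<open>Steering an eigenvector below the tolerance\<close>

text \<open>Only the coefficient of \<open>p\<close> along \<open>\<xi> j\<close> interacts with the first \<open>n\<close> modes, so one scalar equation
  determines \<open>c\<close>. Its solution \<open>- exp (- lam j * (T/2)) / I\<close>, with \<open>I\<close> the response of mode \<open>j\<close> to a unit force,
  stays bounded for large \<open>lam j\<close> because of the midpoint bound on \<open>I\<close>.\<close>

lemma distributed_steering:
  assumes T: "0 < T" and j: "1 \<le> j" "j \<le> n" and p: "p \<in> X"
    and dual: "\<And>i. 1 \<le> i \<Longrightarrow> i \<le> n \<Longrightarrow> p \<bullet> \<xi> i = (if i = j then 1 else 0)"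
  obtains c where "\<bar>c\<bar> \<le> 2 / T * exp (g * T / 4)"
    and "proj n (S (T/2) (\<xi> j) + response (T/2) (c *\<^sub>R p)) = 0"
proof
  define I where "I = integral {0..T/2} (\<lambda>s. exp (- lam j * (T/2 - s)))"
  define c where "c = - exp (- lam j * (T/2)) / I"
  have I: "T/2 * exp (- lam j * (T/2/2)) \<le> I"
    unfolding I_def by (rule exp_integral_ge_midpoint) (use T in simp)
  moreover have "0 < T/2 * exp (- lam j * (T/2/2))" using T by simp
  ultimately have I_pos: "I > 0" by linarith
  have "\<bar>c\<bar> = exp (- lam j * (T/2)) / I" using I_pos by (simp add: c_def)
  also have "\<dots> \<le> exp (- lam j * (T/2)) / (T/2 * exp (- lam j * (T/2/2)))"
    by (rule divide_left_mono[OF I]) (use I_pos T in auto)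
  also have "\<dots> = 2 / T * exp (- lam j * (T/4))"
    using T by (simp add: field_simps flip: exp_add)
  also have "\<dots> \<le> 2 / T * exp (g * (T/4))"
    by (intro mult_left_mono exp_neg_lam_le j) (use T in auto)
  finally show "\<bar>c\<bar> \<le> 2 / T * exp (g * T / 4)" by simp
  have cp: "c *\<^sub>R p \<in> X" by (rule subspace_scale[OF subspace_X p])
  have "(S (T/2) (\<xi> j) + response (T/2) (c *\<^sub>R p)) \<bullet> \<xi> i = 0" if i: "1 \<le> i" "i \<le> n" for i
  proof (cases "i = j")
    case True
    have "response (T/2) (c *\<^sub>R p) \<bullet> \<xi> i = I * (c *\<^sub>R p \<bullet> \<xi> i)"
      using coeff_response[OF cp i(1), of "T/2"] by (simp only: I_def True)
    also have "\<dots> = - exp (- lam j * (T/2))"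
      using I_pos dual[OF i] True by (simp add: c_def)
    finally show ?thesis
      using True j T by (simp add: inner_add_left eigenvector orthonormal)
  next
    case False
    then show ?thesis
      using dual[OF i] i j T by (simp add: inner_add_left coeff_response[OF cp i(1)] eigenvector orthonormal)
  qed
  then show "proj n (S (T/2) (\<xi> j) + response (T/2) (c *\<^sub>R p)) = 0"
    unfolding proj_def by (intro sum.neutral) auto
qed

lemma impulse_steering:
  assumes T: "0 < T" and j: "1 \<le> j" "j \<le> n" and p: "p \<in> X"
    and dual: "\<And>i. 1 \<le> i \<Longrightarrow> i \<le> n \<Longrightarrow> p \<bullet> \<xi> i = (if i = j then 1 else 0)"
  obtains c where "\<bar>c\<bar> \<le> exp (g * T / 4)"
    and "proj n (S (T/2) (\<xi> j) + S (T/4) (c *\<^sub>R p)) = 0"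
proof
  define c where "c = - exp (- lam j * (T/4))"
  show "\<bar>c\<bar> \<le> exp (g * T / 4)"
    using exp_neg_lam_le[OF j(1), of "T/4"] T by (simp add: c_def)
  have cp: "c *\<^sub>R p \<in> X" by (rule subspace_scale[OF subspace_X p])
  have "(S (T/2) (\<xi> j) + S (T/4) (c *\<^sub>R p)) \<bullet> \<xi> i = 0" if i: "1 \<le> i" "i \<le> n" for i
    using dual[OF i] i j T coeff_S[OF _ cp i(1), of "T/4"]
    by (auto simp: inner_add_left eigenvector orthonormal c_def simp flip: exp_add)
  then show "proj n (S (T/2) (\<xi> j) + S (T/4) (c *\<^sub>R p)) = 0"
    unfolding proj_def by (intro sum.neutral) auto
qed

text \<open>The eigenvector \<open>\<xi> j\<close> has no modes beyond \<open>n\<close>, so there the state consists of the contribution \<open>k\<close> of the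
  control alone, which is damped at rate \<open>C\<close>; the modes up to \<open>n\<close> are within the tolerance and
  may grow at rate \<open>g\<close>.\<close>

lemma norm_steered_le:
  assumes T: "0 < T" and j: "1 \<le> j" "j \<le> n" and k: "k \<in> X"
    and low: "norm (proj n (S (T/2) (\<xi> j) + k)) \<le> \<epsilon>" and high: "norm (k - proj n k) \<le> D"
    and C: "\<And>i. n < i \<Longrightarrow> C \<le> lam i"
  shows "norm (S (T/2) (S (T/2) (\<xi> j) + k)) \<le> exp (g * T / 2) * \<epsilon> + exp (- C * T / 2) * D"
proof -
  interpret proj: bounded_linear "proj n" by (rule bounded_linear_proj)
  let ?w = "S (T/2) (\<xi> j) + k"
  have w: "?w \<in> X" using T j k by (intro subspace_add[OF subspace_X] S_in xi_in) auto
  have "proj n ?w = S (T/2) (\<xi> j) + proj n k"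
    using T j by (simp add: proj.add proj.scaleR eigenvector proj_xi)
  then have "norm (?w - proj n ?w) \<le> D" using high by simp
  moreover have "norm (S (T/2) ?w)
      \<le> exp (g * (T/2)) * norm (proj n ?w) + exp (- C * (T/2)) * norm (?w - proj n ?w)"
    by (rule norm_S_split) (use T w C in auto)
  moreover have "exp (g * (T/2)) * norm (proj n ?w) \<le> exp (g * (T/2)) * \<epsilon>"
    using low by (intro mult_left_mono) auto
  moreover have "exp (- C * (T/2)) * norm (?w - proj n ?w) \<le> exp (- C * (T/2)) * D"
    using calculation(1) by (intro mult_left_mono) auto
  ultimately show ?thesis by (simp only: times_divide_eq_right)
qed


section \<open>Contraction over one period\<close>

text \<open>With \<open>p j = y0 \<bullet> Zj j\<close>, symmetry of the semigroup shows that the observation is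
  \<open>S (3T/4) y0 \<bullet> h j = p j - E j c j\<close>, and the contribution of \<open>f j\<close> to the final state is \<open>Yj j - E j \<xi> j\<close>.
  In the product \<open>- (p j - E j c j) (Yj j - E j \<xi> j)\<close> the summand \<open>- E j E j c j \<xi> j\<close> is
  exactly the negative of the free evolution of the \<open>j\<close>-th mode over the period; all other
  summands contain \<open>p j\<close> or \<open>Yj j\<close>, hence a factor \<open>a\<close>. The double error costs \<open>N a\<^sup>2\<close>; the two
  single errors cost \<open>sqrt N a\<close> each, by Cauchy--Schwarz or by orthogonality of the \<open>\<xi> j\<close>.\<close>

lemma period_contraction:
  assumes T: "0 < T" and y0: "y0 \<in> X"
    and f: "\<And>j. j \<in> {1..N} \<Longrightarrow> f j \<in> X" and h: "\<And>j. j \<in> {1..N} \<Longrightarrow> h j \<in> X"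
    and Y: "\<And>j. j \<in> {1..N} \<Longrightarrow> norm (S (T/2) (S (T/2) (\<xi> j) + response (T/2) (f j))) \<le> a"
    and Z: "\<And>j. j \<in> {1..N} \<Longrightarrow> norm (S (T/2) (S (T/2) (\<xi> j) + S (T/4) (h j))) \<le> a"
    and high: "\<And>j. N < j \<Longrightarrow> \<mu> \<le> lam j" and a: "0 \<le> a"
  shows "norm (S (2*T) y0 + S (T/2) (response (T/2) (feedback N f h (S (3*T/4) y0))))
    \<le> (exp (- 2 * \<mu> * T) + real N * a\<^sup>2 + 2 * sqrt (real N) * a * exp (g * T)) * norm y0"
proof -
  define E where "E j = exp (- lam j * T)" for j
  define Yj where "Yj j = S (T/2) (S (T/2) (\<xi> j) + response (T/2) (f j))" for j
  define Zj where "Zj j = S (T/2) (S (T/2) (\<xi> j) + S (T/4) (h j))" for j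
  define c where "c j = y0 \<bullet> \<xi> j" for j
  define p where "p j = y0 \<bullet> Zj j" for j
  have SS: "S (T/2) (S (T/2) (\<xi> j)) = E j *\<^sub>R \<xi> j" if "1 \<le> j" for j
    using T that S_comp[of "T/2" "T/2" "\<xi> j"] eigenvector[of j T] by (simp only: E_def xi_in) simp
  have Yj: "S (T/2) (response (T/2) (f j)) = Yj j - E j *\<^sub>R \<xi> j" if j: "j \<in> {1..N}" for j
    using S_add[of "T/2" "S (T/2) (\<xi> j)" "response (T/2) (f j)"] T j f[OF j]
    by (simp add: Yj_def SS S_in xi_in response_in)
  have Zj: "S (3*T/4) (h j) = Zj j - E j *\<^sub>R \<xi> j" if j: "j \<in> {1..N}" for j
    using S_add[of "T/2" "S (T/2) (\<xi> j)" "S (T/4) (h j)"] S_comp[of "T/2" "T/4" "h j"] T j h[OF j]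
    by (simp add: Zj_def SS S_in xi_in)
  have obs: "S (3*T/4) y0 \<bullet> h j = p j - E j * c j" if j: "j \<in> {1..N}" for j
    using S_symmetric[of "3*T/4" y0 "h j"] T y0 h[OF j]
    by (simp add: Zj[OF j] inner_diff_right p_def c_def)
  have "feedback N f h (S (3*T/4) y0) = (\<Sum>j=1..N. (E j * c j - p j) *\<^sub>R f j)"
    unfolding feedback_def sum_negf[symmetric]
    by (rule sum.cong) (simp_all add: obs flip: scaleR_minus_left)
  then have "response (T/2) (feedback N f h (S (3*T/4) y0))
      = (\<Sum>j=1..N. (E j * c j - p j) *\<^sub>R response (T/2) (f j))"
    using response_sum[of "{1..N}" f "T/2" "\<lambda>j. E j * c j - p j"] f by (simp only: finite_atLeastAtMost)
  then have "S (T/2) (response (T/2) (feedback N f h (S (3*T/4) y0)))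
      = (\<Sum>j=1..N. (E j * c j - p j) *\<^sub>R S (T/2) (response (T/2) (f j)))"
    using S_combination[of "T/2" "{1..N}" "\<lambda>j. response (T/2) (f j)" "\<lambda>j. E j * c j - p j"] T f
    by (simp only: response_in)
  also have "\<dots> = (\<Sum>j=1..N. (E j * c j) *\<^sub>R Yj j + (p j * E j) *\<^sub>R \<xi> j - p j *\<^sub>R Yj j
      - (E j * E j * c j) *\<^sub>R \<xi> j)"
    by (rule sum.cong) (simp_all add: Yj algebra_simps)
  finally have control: "S (T/2) (response (T/2) (feedback N f h (S (3*T/4) y0)))
      = (\<Sum>j=1..N. (E j * c j) *\<^sub>R Yj j) + (\<Sum>j=1..N. (p j * E j) *\<^sub>R \<xi> j)
        - (\<Sum>j=1..N. p j *\<^sub>R Yj j) - (\<Sum>j=1..N. (E j * E j * c j) *\<^sub>R \<xi> j)"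
    by (simp only: sum.distrib sum_subtractf)
  have "exp (- lam j * (2*T)) = E j * E j" for j by (simp add: E_def mult_ac flip: exp_add)
  then have "S (2*T) (proj N y0) = (\<Sum>j=1..N. (E j * E j * c j) *\<^sub>R \<xi> j)"
    using S_proj_eq[of "2*T" N y0] T by (simp add: c_def)
  moreover have "S (2*T) (y0 - proj N y0) = S (2*T) y0 - S (2*T) (proj N y0)"
    using T y0 by (simp add: S_diff proj_in)
  ultimately have split: "S (2*T) y0 + S (T/2) (response (T/2) (feedback N f h (S (3*T/4) y0)))
      = S (2*T) (y0 - proj N y0) + (\<Sum>j=1..N. (E j * c j) *\<^sub>R Yj j)
        + (\<Sum>j=1..N. (p j * E j) *\<^sub>R \<xi> j) - (\<Sum>j=1..N. p j *\<^sub>R Yj j)" (is "_ = ?A + ?B + ?C - ?D")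
    by (simp add: control)
  have A: "norm ?A \<le> exp (- 2 * \<mu> * T) * norm y0"
  proof -
    have "norm ?A \<le> exp (- \<mu> * (2*T)) * norm (y0 - proj N y0)"
      by (rule norm_S_diff_proj) (use T y0 high in auto)
    also have "\<dots> \<le> exp (- \<mu> * (2*T)) * norm y0"
      by (intro mult_left_mono norm_diff_proj_le_norm) auto
    finally show ?thesis by (simp add: mult_ac)
  qed
  have p_le: "\<bar>p j\<bar> \<le> a * norm y0" if "j \<in> {1..N}" for j
  proof -
    have "\<bar>p j\<bar> \<le> norm y0 * norm (Zj j)" unfolding p_def by (rule Cauchy_Schwarz_ineq2)
    also have "\<dots> \<le> norm y0 * a" using Z[OF that] by (intro mult_left_mono) (auto simp: Zj_def)
    finally show ?thesis by (simp add: mult.commute)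
  qed
  have E_le: "\<bar>E j\<bar> \<le> exp (g * T)" if "j \<in> {1..N}" for j
    using exp_neg_lam_le[of j T] T that by (simp add: E_def)
  have B: "norm ?B \<le> sqrt (real N) * a * exp (g * T) * norm y0"
  proof -
    have "norm ?B \<le> (\<Sum>j=1..N. exp (g * T) * \<bar>c j\<bar> * a)"
    proof (rule sum_norm_le)
      fix j assume j: "j \<in> {1..N}"
      have "\<bar>E j\<bar> * \<bar>c j\<bar> * norm (Yj j) \<le> exp (g * T) * \<bar>c j\<bar> * a"
        using Y[OF j] E_le[OF j] by (intro mult_mono) (auto simp: Yj_def)
      then show "norm ((E j * c j) *\<^sub>R Yj j) \<le> exp (g * T) * \<bar>c j\<bar> * a" by (simp add: abs_mult)
    qed
    also have "\<dots> = exp (g * T) * a * (\<Sum>j=1..N. \<bar>c j\<bar>)"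
      by (simp add: sum_distrib_left mult_ac)
    also have "\<dots> \<le> exp (g * T) * a * (sqrt (real N) * norm y0)"
      using sum_abs_coeff_le[of y0 N] a by (intro mult_left_mono) (auto simp: c_def)
    finally show ?thesis by (simp add: mult_ac)
  qed
  have C: "norm ?C \<le> sqrt (real N) * a * exp (g * T) * norm y0"
  proof (rule power2_le_imp_le)
    have "(norm ?C)\<^sup>2 = (\<Sum>j=1..N. (p j * E j)\<^sup>2)" by (rule norm_xi_combination)
    also have "\<dots> \<le> (\<Sum>j=1..N. (a * norm y0 * exp (g * T))\<^sup>2)"
    proof (rule sum_mono)
      fix j assume j: "j \<in> {1..N}"
      have "\<bar>p j * E j\<bar> \<le> a * norm y0 * exp (g * T)"
        unfolding abs_mult using p_le[OF j] E_le[OF j] a by (intro mult_mono) auto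
      then show "(p j * E j)\<^sup>2 \<le> (a * norm y0 * exp (g * T))\<^sup>2"
        using a by (intro power2_le_iff_abs_le[THEN iffD2]) auto
    qed
    also have "\<dots> = (sqrt (real N) * a * exp (g * T) * norm y0)\<^sup>2"
      by (simp add: power_mult_distrib mult_ac)
    finally show "(norm ?C)\<^sup>2 \<le> (sqrt (real N) * a * exp (g * T) * norm y0)\<^sup>2" .
  qed (use a in simp)
  have D: "norm ?D \<le> real N * a\<^sup>2 * norm y0"
  proof -
    have "norm ?D \<le> (\<Sum>j=1..N. a * norm y0 * a)"
    proof (rule sum_norm_le)
      fix j assume j: "j \<in> {1..N}"
      show "norm (p j *\<^sub>R Yj j) \<le> a * norm y0 * a"
        using p_le[OF j] Y[OF j] a by (auto simp: Yj_def intro!: mult_mono)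
    qed
    then show ?thesis by (simp add: power2_eq_square mult_ac)
  qed
  have "norm (?A + ?B + ?C - ?D) \<le> norm ?A + norm ?B + norm ?C + norm ?D"
    by (meson norm_triangle_le norm_triangle_le_diff order_refl add_right_mono)
  then show ?thesis unfolding split distrib_right using A B C D by linarith
qed


section \<open>Closed-loop trajectories\<close>

text \<open>The variation-of-constants formula may be restarted at any time \<open>a\<close>: on \<open>[0, a]\<close> the operator
  \<open>S (t - a)\<close> can be taken out of the integral.\<close>

lemma mild_solution_restart:
  assumes sol: "mild_solution S {0..} y0 u y" and y0: "y0 \<in> X" and u: "\<And>s. u s \<in> X"
    and at: "0 \<le> a" "a \<le> t"
  shows "((\<lambda>s. S (t - s) (u s)) has_integral (y t - S (t - a) (y a))) {a..t}"
    and "y a \<in> X"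
proof -
  have int: "((\<lambda>s. S (t - s) (u s)) has_integral (y t - S t y0)) {0..t}" if "0 \<le> t" for t
    using sol that by (simp add: mild_solution_def)
  have "y a - S a y0 \<in> X"
    by (rule integral_in_X[OF int[OF at(1)]]) (auto intro: S_in u)
  then have "(y a - S a y0) + S a y0 \<in> X"
    by (rule subspace_add[OF subspace_X]) (intro S_in at y0)
  then show ya: "y a \<in> X" by simp
  have "(((\<lambda>v. S (t - a) (P v)) \<circ> (\<lambda>s. S (a - s) (u s))) has_integral S (t - a) (P (y a - S a y0))) {0..a}"
    by (rule has_integral_linear[OF int[OF at(1)] bounded_linear_SP]) (use at in simp)
  then have "((\<lambda>s. S (t - s) (u s)) has_integral S (t - a) (P (y a - S a y0))) {0..a}"
    by (rule has_integral_eq[rotated]) (use at u in \<open>simp add: P_id S_in S_comp\<close>)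
  moreover have "S (t - a) (P (y a - S a y0)) = S (t - a) (y a) - S t y0"
    using at ya y0 by (simp add: P_id subspace_diff[OF subspace_X] S_in S_diff S_comp)
  ultimately have left: "((\<lambda>s. S (t - s) (u s)) has_integral S (t - a) (y a) - S t y0) {0..a}"
    by simp
  have whole: "((\<lambda>s. S (t - s) (u s)) has_integral (y t - S t y0)) {0..t}"
    using int at by simp
  then have "(\<lambda>s. S (t - s) (u s)) integrable_on {a..t}"
    using at by (intro integrable_subinterval_real[OF has_integral_integrable[OF whole]]) auto
  then obtain J where J: "((\<lambda>s. S (t - s) (u s)) has_integral J) {a..t}" by blast
  have "S (t - a) (y a) - S t y0 + J = y t - S t y0"
    by (rule has_integral_unique[OF has_integral_combine[OF at left J] whole])
  then have "J = y t - S (t - a) (y a)" by (simp add: algebra_simps)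
  then show "((\<lambda>s. S (t - s) (u s)) has_integral (y t - S (t - a) (y a))) {a..t}" using J by simp
qed

lemma mild_solution_constant_force:
  assumes sol: "mild_solution S {0..} y0 u y" and y0: "y0 \<in> X" and u: "\<And>s. u s \<in> X"
    and at: "0 \<le> a" "0 \<le> r" and const: "\<And>s. a \<le> s \<Longrightarrow> s < a + r \<Longrightarrow> u s = w" and w: "w \<in> X"
  shows "y (a + r) = S r (y a) + response r w"
proof -
  have "((\<lambda>s. S (a + r - s) (u s)) has_integral (y (a + r) - S r (y a))) {a..a + r}"
    using mild_solution_restart(1)[OF sol y0 u at(1), of "a + r"] at(2) by simp
  then have "((\<lambda>s. S (a + r - s) w) has_integral (y (a + r) - S r (y a))) {a..a + r}"
    by (rule has_integral_spike_finite[of "{a + r}", rotated 2]) (auto simp: const)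
  moreover have "((\<lambda>s. S (a + r - s) w) has_integral response r w) {a..a + r}"
    using has_integral_response[OF w, of r] has_integral_shift_real_ivl_iff[of "\<lambda>s. S (a + r - s) w" _ a "a + r" a]
    by simp
  ultimately have "y (a + r) - S r (y a) = response r w" by (rule has_integral_unique)
  then show ?thesis by (simp add: algebra_simps)
qed

text \<open>Each of the stages free, forced, free is an instance of the constant-force formula, with force
  \<open>0\<close>, \<open>w\<close>, \<open>0\<close>; the semigroup law composes them.\<close>

lemma mild_solution_period:
  assumes sol: "mild_solution S {0..} y0 u y" and y0: "y0 \<in> X" and u: "\<And>s. u s \<in> X"
    and a: "0 \<le> a" and T: "0 < T" and w: "w \<in> X"
    and pulse: "\<And>s. a \<le> s \<Longrightarrow> s < a + 2*T \<Longrightarrow> u s = indicator {a + T ..< a + 3/2*T} s *\<^sub>R w"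
  shows "0 \<le> r \<Longrightarrow> r \<le> T \<Longrightarrow> y (a + r) = S r (y a)"
    and "y (a + 2*T) = S (2*T) (y a) + S (T/2) (response (T/2) w)"
    and "0 \<le> r \<Longrightarrow> r \<le> 2*T \<Longrightarrow> norm (y (a + r)) \<le> exp (g * r) * norm (y a) + T/2 * exp (g * T) * norm w"
proof -
  have yX: "y s \<in> X" if "0 \<le> s" for s
    using mild_solution_restart(2)[OF sol y0 u that order_refl] .
  have zero: "(0::'b) \<in> X" by (rule subspace_0[OF subspace_X])
  have free: "y (a + r) = S r (y a)" if "0 \<le> r" "r \<le> T" for r
    using mild_solution_constant_force[OF sol y0 u a that(1) _ zero] pulse that T
    by (simp add: response_zero indicator_def)
  have forced: "y (a + T + r) = S r (y (a + T)) + response r w" if "0 \<le> r" "r \<le> T/2" for r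
    using mild_solution_constant_force[OF sol y0 u _ that(1) _ w, of "a + T"] pulse that T a
    by (simp add: indicator_def)
  have free': "y (a + 3/2*T + r) = S r (y (a + 3/2*T))" if "0 \<le> r" "r \<le> T/2" for r
    using mild_solution_constant_force[OF sol y0 u _ that(1) _ zero, of "a + 3/2*T"] pulse that T a
    by (simp add: response_zero indicator_def)
  have mid: "y (a + T + r) = S (T + r) (y a) + response r w" if "0 \<le> r" "r \<le> T/2" for r
    using forced[OF that] free[of T] that T a yX[OF a] by (simp add: S_comp add.commute)
  have late: "y (a + 3/2*T + r) = S (3/2*T + r) (y a) + S r (response (T/2) w)"
    if "0 \<le> r" "r \<le> T/2" for r
    using free'[OF that] mid[of "T/2"] that T a yX[OF a] w
    by (simp add: S_add S_in response_in S_comp algebra_simps)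
  show "0 \<le> r \<Longrightarrow> r \<le> T \<Longrightarrow> y (a + r) = S r (y a)" by (rule free)
  show "y (a + 2*T) = S (2*T) (y a) + S (T/2) (response (T/2) w)"
    using late[of "T/2"] T by (simp add: algebra_simps)
  assume r: "0 \<le> r" "r \<le> 2*T"
  have sum: "norm (S r (y a) + k) \<le> exp (g * r) * norm (y a) + T/2 * exp (g * T) * norm w"
    if "norm k \<le> T/2 * exp (g * T) * norm w" for k
    using norm_triangle_mono[OF norm_S_growth[OF r(1) yX[OF a]] that] .
  have resp: "norm (response b w) \<le> T/2 * exp (g * b) * norm w" if "0 \<le> b" "b \<le> T/2" for b
  proof -
    have "b * (exp (g * b) * norm w) \<le> T/2 * (exp (g * b) * norm w)"
      using that by (intro mult_right_mono) auto
    with norm_response_le[OF that(1) w] show ?thesis unfolding mult.assoc by (rule order_trans)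
  qed
  consider "r \<le> T" | "T < r" "r \<le> 3/2*T" | "3/2*T < r" by linarith
  then show "norm (y (a + r)) \<le> exp (g * r) * norm (y a) + T/2 * exp (g * T) * norm w"
  proof cases
    case 1
    then show ?thesis using sum[of 0] free[OF r(1)] T by simp
  next
    case 2
    have "norm (response (r - T) w) \<le> T/2 * exp (g * (r - T)) * norm w"
      using 2 by (intro resp) auto
    also have "\<dots> \<le> T/2 * exp (g * T) * norm w"
      using 2 T g_nonneg by (intro mult_right_mono mult_left_mono) (auto intro: mult_left_mono)
    finally show ?thesis using mid[of "r - T"] sum 2 by simp
  next
    case 3
    define s where "s = r - 3/2*T"
    have s: "0 \<le> s" "s \<le> T/2" using 3 r by (auto simp: s_def)
    have "norm (S s (response (T/2) w)) \<le> exp (g * s) * norm (response (T/2) w)"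
      by (intro norm_S_growth s response_in w)
    also have "\<dots> \<le> exp (g * s) * (T/2 * exp (g * (T/2)) * norm w)"
      using T by (intro mult_left_mono resp) auto
    also have "\<dots> = T/2 * exp (g * (s + T/2)) * norm w"
      by (simp add: distrib_left exp_add)
    also have "\<dots> \<le> T/2 * exp (g * T) * norm w"
      using s T g_nonneg by (intro mult_right_mono mult_left_mono) (auto intro: mult_left_mono)
    finally show ?thesis using late[OF s] sum by (simp add: s_def)
  qed
qed

text \<open>The observation of the \<open>i\<close>-th period is taken at \<open>3T/4\<close>, before the control acts, so it depends on the
  state \<open>y (2 i T)\<close> only, and the map from \<open>y (2 i T)\<close> to \<open>y (2 (i + 1) T)\<close> is the one assumed to
  contract. Inside the period of \<open>t\<close>, replacing \<open>2 i T\<close> by \<open>t\<close> in the exponent loses \<open>exp (2 \<gamma> T)\<close>.\<close>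

lemma closed_loop_decay:
  assumes sol: "mild_solution S {0..} (y 0) u y" and y0: "y 0 \<in> X" and u: "\<And>s. u s \<in> X"
    and T: "0 < T" and \<gamma>: "0 \<le> \<gamma>"
    and G: "\<And>v. v \<in> X \<Longrightarrow> G v \<in> X" "\<And>v. v \<in> X \<Longrightarrow> norm (G v) \<le> \<Phi> * norm v" and \<Phi>: "0 \<le> \<Phi>"
    and pulse: "\<And>i s. 2 * real i * T \<le> s \<Longrightarrow> s < 2 * real i * T + 2*T \<Longrightarrow>
      u s = indicator {(2 * real i + 1) * T ..< (2 * real i + 3/2) * T} s *\<^sub>R G (y ((2 * real i + 3/4) * T))"
    and contraction: "\<And>v. v \<in> X \<Longrightarrow>
      norm (S (2*T) v + S (T/2) (response (T/2) (G (S (3*T/4) v)))) \<le> exp (- 2 * \<gamma> * T) * norm v"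
    and t: "0 \<le> t"
  shows "norm (y t) \<le> (1 + T/2 * \<Phi>) * exp ((2 * g + 2 * \<gamma>) * T) * exp (- \<gamma> * t) * norm (y 0)"
proof -
  have yX: "y s \<in> X" if "0 \<le> s" for s
    using mild_solution_restart(2)[OF sol y0 u that order_refl] .
  define a where "a i = 2 * real i * T" for i
  have a: "0 \<le> a i" for i using T by (simp add: a_def)
  define w where "w i = G (y (a i + 3/4*T))" for i
  have w: "w i \<in> X" for i unfolding w_def using T a by (intro G yX) auto
  have pulse': "u s = indicator {a i + T ..< a i + 3/2*T} s *\<^sub>R w i"
    if "a i \<le> s" "s < a i + 2*T" for i s
    using pulse[of i s] that by (simp add: a_def w_def distrib_right)
  have free: "y (a i + r) = S r (y (a i))" if "0 \<le> r" "r \<le> T" for i r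
    by (rule mild_solution_period(1)[OF sol y0 u a T w pulse' that])
  have full: "y (a i + 2*T) = S (2*T) (y (a i)) + S (T/2) (response (T/2) (w i))" for i
    by (rule mild_solution_period(2)[OF sol y0 u a T w pulse'])
  have observed: "y (a i + 3/4*T) = S (3*T/4) (y (a i))" for i
    using free[of "3/4*T" i] T by (simp add: mult_ac)
  have step: "norm (y (a i + 2*T)) \<le> exp (- 2 * \<gamma> * T) * norm (y (a i))" for i
    using full[of i] contraction[OF yX[OF a]] by (simp only: w_def observed)
  have decay: "norm (y (a i)) \<le> exp (- 2 * \<gamma> * T * real i) * norm (y 0)" for i
  proof (induction i)
    case 0
    then show ?case by (simp add: a_def)
  next
    case (Suc i)
    have "a (Suc i) = a i + 2*T" by (simp add: a_def algebra_simps)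
    then have "norm (y (a (Suc i))) \<le> exp (- 2 * \<gamma> * T) * norm (y (a i))" using step by simp
    also have "\<dots> \<le> exp (- 2 * \<gamma> * T) * (exp (- 2 * \<gamma> * T * real i) * norm (y 0))"
      by (intro mult_left_mono Suc) auto
    finally show ?case by (simp add: algebra_simps flip: exp_add)
  qed
  define i where "i = nat \<lfloor>t / (2*T)\<rfloor>"
  define r where "r = t - a i"
  have i_floor: "real i = of_int \<lfloor>t / (2*T)\<rfloor>" using t T by (simp add: i_def)
  have "real i \<le> t / (2*T)" "t / (2*T) < real i + 1"
    unfolding i_floor by linarith+
  then have r: "0 \<le> r" "r \<le> 2*T"
    using T by (simp_all add: r_def a_def field_simps)
  have w_le: "norm (w i) \<le> \<Phi> * (exp (g * T) * norm (y (a i)))"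
  proof -
    have "norm (w i) \<le> \<Phi> * norm (S (3*T/4) (y (a i)))"
      unfolding w_def observed using T a by (intro G S_in yX) auto
    also have "\<dots> \<le> \<Phi> * (exp (g * (3*T/4)) * norm (y (a i)))"
      using T a by (intro mult_left_mono \<Phi> norm_S_growth yX) auto
    also have "\<dots> \<le> \<Phi> * (exp (g * T) * norm (y (a i)))"
      using T g_nonneg by (intro mult_left_mono mult_right_mono \<Phi>) (auto intro: mult_left_mono)
    finally show ?thesis .
  qed
  have "norm (y (a i + r)) \<le> exp (g * r) * norm (y (a i)) + T/2 * exp (g * T) * norm (w i)"
    by (rule mild_solution_period(3)[OF sol y0 u a T w pulse' r])
  also have "\<dots> \<le> exp (g * (2*T)) * norm (y (a i))
      + T/2 * exp (g * T) * (\<Phi> * (exp (g * T) * norm (y (a i))))"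
  proof (rule add_mono)
    show "exp (g * r) * norm (y (a i)) \<le> exp (g * (2*T)) * norm (y (a i))"
      using r g_nonneg by (intro mult_right_mono) (auto intro: mult_left_mono)
    show "T/2 * exp (g * T) * norm (w i) \<le> T/2 * exp (g * T) * (\<Phi> * (exp (g * T) * norm (y (a i))))"
      using T by (intro mult_left_mono w_le) auto
  qed
  also have "\<dots> = (1 + T/2 * \<Phi>) * exp (g * (2*T)) * norm (y (a i))"
    by (simp add: algebra_simps flip: exp_add)
  also have "\<dots> \<le> (1 + T/2 * \<Phi>) * exp (g * (2*T)) * (exp (- 2 * \<gamma> * T * real i) * norm (y 0))"
    using T \<Phi> by (intro mult_left_mono decay) auto
  also have "\<dots> \<le> (1 + T/2 * \<Phi>) * exp (g * (2*T)) * (exp (2 * \<gamma> * T - \<gamma> * t) * norm (y 0))"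
  proof (intro mult_left_mono mult_right_mono)
    have "\<gamma> * (t - a i) \<le> \<gamma> * (2*T)" using r \<gamma> by (intro mult_left_mono) (auto simp: r_def)
    then show "exp (- 2 * \<gamma> * T * real i) \<le> exp (2 * \<gamma> * T - \<gamma> * t)"
      by (simp add: a_def algebra_simps)
  qed (use T \<Phi> in auto)
  also have "\<dots> = (1 + T/2 * \<Phi>) * exp ((2 * g + 2 * \<gamma>) * T) * exp (- \<gamma> * t) * norm (y 0)"
    by (simp add: algebra_simps flip: exp_add)
  finally show ?thesis by (simp add: r_def)
qed

end


section \<open>The choice of the constants\<close>

text \<open>The threshold exceeds both the decay rate that defines \<open>N\<close> and, for the relevant \<open>cp\<close>, the first
  positive eigenvalue. So \<open>N \<le> M\<close>, and \<open>lam M \<ge> 0\<close> as the spectral inequality demands.\<close>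

lemma threshold_ge:
  assumes T: "0 < T" and C1: "0 \<le> C1" and g: "0 \<le> g" and \<gamma>: "0 \<le> \<gamma>" and N: "1 \<le> N"
  shows "4 * \<gamma> + 3 * g + 2 * ln 9 / T + cp \<le> threshold C1 g cp N \<gamma> T"
proof -
  define L where "L = ln (9 * sqrt (real N))"
  define G where "G = 1 + g powr (2/3)"
  define Q where "Q = C1\<^sup>2 + 2 * T * (L + C1 * G) + (4 * \<gamma> + 3 * g) * T\<^sup>2"
  have L: "ln 9 \<le> L" using N by (simp add: L_def)
  have G: "0 \<le> G" by (simp add: G_def)
  have "2 * T * ln 9 \<le> 2 * T * (L + C1 * G)"
    using T C1 G L by (intro mult_left_mono) (auto intro: add_increasing2)
  then have Q: "2 * T * ln 9 + (4 * \<gamma> + 3 * g) * T\<^sup>2 \<le> Q"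
    unfolding Q_def using zero_le_power2[of C1] by linarith
  moreover have "0 \<le> 2 * T * ln 9 + (4 * \<gamma> + 3 * g) * T\<^sup>2" using T g \<gamma> by simp
  ultimately have "Q \<ge> 0" by linarith
  then have "Q \<le> (C1 + sqrt Q)\<^sup>2"
    using C1 power_mono[of "sqrt Q" "C1 + sqrt Q" 2] by simp
  with Q have "2 * T * ln 9 + (4 * \<gamma> + 3 * g) * T\<^sup>2 \<le> (C1 + sqrt Q)\<^sup>2" by linarith
  then have "(2 * T * ln 9 + (4 * \<gamma> + 3 * g) * T\<^sup>2) / T\<^sup>2 \<le> ((C1 + sqrt Q) / T)\<^sup>2"
    unfolding power_divide by (rule divide_right_mono) simp
  moreover have "(2 * T * ln 9 + (4 * \<gamma> + 3 * g) * T\<^sup>2) / T\<^sup>2 = 4 * \<gamma> + 3 * g + 2 * ln 9 / T"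
    using T by (simp add: add_divide_distrib power2_eq_square)
  ultimately show ?thesis by (simp add: threshold_def Q_def L_def G_def)
qed

text \<open>For \<open>cp = 0\<close> the threshold is \<open>r\<^sup>2\<close>, where \<open>r\<close> is the positive root of
  \<open>T r\<^sup>2 / 2 = C1 r + L + C1 G + (2 \<gamma> + 3 g / 2) T\<close>: the damping balances the control cost. Adding \<open>cp\<close> to
  the threshold increases the cost exponent \<open>C1 sqrt l\<close> by at most \<open>C1 cp / (2 r) \<le> cp T / 2\<close>, since
  \<open>T r \<ge> 2 C1\<close>, and this is what the additional damping pays for.\<close>

lemma high_mode_exponent:
  assumes T: "0 < T" and C1: "0 < C1" and g: "0 \<le> g" and \<gamma>: "0 \<le> \<gamma>" and N: "1 \<le> N"
    and cp: "0 \<le> cp" and l: "l \<le> threshold C1 g cp N \<gamma> T"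
  shows "- threshold C1 g cp N \<gamma> T * T / 2 + C1 * (1 + g powr (2/3) + sqrt l)
    \<le> - ln (9 * sqrt (real N)) - (2 * \<gamma> + 3/2 * g) * T"
proof -
  define L where "L = ln (9 * sqrt (real N))"
  define G where "G = 1 + g powr (2/3)"
  define Q where "Q = C1\<^sup>2 + 2 * T * (L + C1 * G) + (4 * \<gamma> + 3 * g) * T\<^sup>2"
  define r where "r = (C1 + sqrt Q) / T"
  have C: "threshold C1 g cp N \<gamma> T = r\<^sup>2 + cp"
    by (simp add: threshold_def Q_def L_def G_def r_def)
  have "1 * 1 \<le> 9 * sqrt (real N)" using N by (intro mult_mono) auto
  then have "0 \<le> L" "0 \<le> G" by (simp_all add: L_def G_def)
  then have "0 \<le> 2 * T * (L + C1 * G) + (4 * \<gamma> + 3 * g) * T\<^sup>2"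
    using T C1 g \<gamma> by simp
  then have Q: "C1\<^sup>2 \<le> Q" by (simp add: Q_def)
  then have "C1 \<le> sqrt Q" using C1 by (simp add: real_le_rsqrt)
  then have Tr: "2 * C1 \<le> T * r" using T by (simp add: r_def)
  then have r: "0 < r" using C1 T by (smt (verit) zero_less_mult_pos)
  have "0 \<le> Q" using Q zero_le_power2[of C1] by linarith
  then have "(T * r - C1)\<^sup>2 = Q" using T by (simp add: r_def)
  then have "T * (T * r\<^sup>2) = T * (2 * C1 * r + 2 * (L + C1 * G) + (4 * \<gamma> + 3 * g) * T)"
    by (simp add: Q_def power2_eq_square algebra_simps)
  then have root: "T * r\<^sup>2 = 2 * C1 * r + 2 * (L + C1 * G) + (4 * \<gamma> + 3 * g) * T"
    using T by simp
  have "sqrt l \<le> r + cp / (2 * r)"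
  proof (rule real_le_lsqrt)
    have "(r + cp / (2 * r))\<^sup>2 = r\<^sup>2 + cp + (cp / (2 * r))\<^sup>2"
      using r by (simp add: power2_sum)
    then show "l \<le> (r + cp / (2 * r))\<^sup>2" using l unfolding C by (smt (verit) zero_le_power2)
  qed (use r cp in simp)
  then have "C1 * sqrt l \<le> C1 * (r + cp / (2 * r))" using C1 by (intro mult_left_mono) auto
  moreover have "C1 * (cp / (2 * r)) \<le> cp * T / 2"
  proof -
    have "C1 * cp \<le> (T * r) * cp"
      using Tr C1 cp by (intro mult_right_mono) auto
    then show ?thesis using r by (simp add: field_simps)
  qed
  ultimately have l_le: "C1 * sqrt l \<le> C1 * r + cp * T / 2"
    unfolding distrib_left by linarith
  have "- (r\<^sup>2 + cp) * T / 2 + C1 * (G + sqrt l)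
      = - (T * r\<^sup>2) / 2 - cp * T / 2 + C1 * G + C1 * sqrt l"
    by (simp add: field_simps)
  also have "\<dots> \<le> - (2 * C1 * r + 2 * (L + C1 * G) + (4 * \<gamma> + 3 * g) * T) / 2 + C1 * G + C1 * r"
    unfolding root using l_le by linarith
  also have "\<dots> = - L - (2 * \<gamma> + 3/2 * g) * T"
    by (simp add: field_simps)
  finally show ?thesis
    unfolding C L_def[symmetric] G_def[symmetric] .
qed

text \<open>Both parts of a steered state, the tolerated low modes after growth at rate \<open>g\<close> for time \<open>T / 2\<close> and the damped
  high modes, contribute at most half of the right-hand side.\<close>

lemma steering_budget:
  assumes T: "0 < T" and C1: "0 < C1" and g: "0 \<le> g" and \<gamma>: "0 \<le> \<gamma>" and N: "1 \<le> N"
    and cp: "0 \<le> cp" and l: "l \<le> threshold C1 g cp N \<gamma> T"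
  shows "exp (g * T / 2) * tolerance g cp N \<gamma> T + exp (- threshold C1 g cp N \<gamma> T * T / 2)
      * (exp (g * T / 4) * exp (C1 * (1 + g powr (2/3) + sqrt l)))
    \<le> 2 / (9 * sqrt (real N)) * exp (- (2 * \<gamma> + g) * T)"
proof -
  define L where "L = ln (9 * sqrt (real N))"
  have expL: "exp (- L) = 1 / (9 * sqrt (real N))"
    using N by (simp add: L_def exp_minus inverse_eq_divide)
  have "exp (g * T / 2) * tolerance g cp N \<gamma> T = exp (g * T / 2 - L - (2 * \<gamma> + 3 / 2 * g + cp) * T)"
    unfolding tolerance_def expL[symmetric] by (simp add: algebra_simps flip: exp_add)
  also have "\<dots> \<le> exp (- L - (2 * \<gamma> + g) * T)"
    using T cp by (simp add: algebra_simps)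
  finally have low: "exp (g * T / 2) * tolerance g cp N \<gamma> T \<le> exp (- L - (2 * \<gamma> + g) * T)" .
  have "exp (- threshold C1 g cp N \<gamma> T * T / 2)
      * (exp (g * T / 4) * exp (C1 * (1 + g powr (2/3) + sqrt l)))
    = exp (g * T / 4 + (- threshold C1 g cp N \<gamma> T * T / 2 + C1 * (1 + g powr (2/3) + sqrt l)))"
    by (simp only: exp_add mult_ac)
  also have "\<dots> \<le> exp (g * T / 4 + (- L - (2 * \<gamma> + 3/2 * g) * T))"
    using high_mode_exponent[OF assms] by (simp add: L_def)
  also have "\<dots> \<le> exp (- L - (2 * \<gamma> + g) * T)"
    using T g by (simp add: algebra_simps)
  finally have high: "exp (- threshold C1 g cp N \<gamma> T * T / 2)
      * (exp (g * T / 4) * exp (C1 * (1 + g powr (2/3) + sqrt l))) \<le> exp (- L - (2 * \<gamma> + g) * T)" .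
  have "exp (- L - (2 * \<gamma> + g) * T) = exp (- L) * exp (- (2 * \<gamma> + g) * T)"
    unfolding exp_add[symmetric] by (simp add: algebra_simps)
  then show ?thesis using add_mono[OF low high] by (simp add: expL)
qed

text \<open>In units of \<open>exp (- 2 \<gamma> T)\<close> the summands are at most \<open>1/81\<close>, \<open>4/81\<close> and \<open>36/81\<close>.\<close>

lemma contraction_factor_le:
  assumes T: "0 < T" and g: "0 \<le> g" and \<gamma>: "0 \<le> \<gamma>" and N: "1 \<le> N"
    and a: "a = 2 / (9 * sqrt (real N)) * exp (- (2 * \<gamma> + g) * T)"
  shows "exp (- 2 * (2 * \<gamma> + ln 9 / T) * T) + real N * a\<^sup>2 + 2 * sqrt (real N) * a * exp (g * T)
    \<le> exp (- 2 * \<gamma> * T)"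
proof -
  let ?x = "exp (- 2 * \<gamma> * T)"
  have smaller: "exp (- 2 * (2 * \<gamma> + b) * T) \<le> ?x" if "0 \<le> b" for b
  proof -
    have "2 * \<gamma> * T \<le> 2 * (2 * \<gamma> + b) * T"
      using T \<gamma> that by (intro mult_right_mono) auto
    then show ?thesis
      by (simp only: exp_le_cancel_iff mult_minus_left neg_le_iff_le)
  qed
  have "exp (- 2 * (2 * \<gamma> + ln 9 / T) * T) = exp (- 2 * (2 * \<gamma> + 0) * T) * exp (- (2 * ln 9))"
    using T by (simp add: algebra_simps flip: exp_add)
  also have "exp (- (2 * ln 9)) = (1 / 81 :: real)"
    using exp_of_nat_mult[of 2 "ln (9::real)"] by (simp add: exp_minus power2_eq_square)
  finally have 1: "exp (- 2 * (2 * \<gamma> + ln 9 / T) * T) \<le> ?x / 81"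
    using smaller[of 0] by simp
  have "real N * a\<^sup>2 = 4/81 * (exp (- (2 * \<gamma> + g) * T))\<^sup>2"
    using N by (simp add: a power_mult_distrib power_divide)
  also have "(exp (- (2 * \<gamma> + g) * T))\<^sup>2 = exp (- 2 * (2 * \<gamma> + g) * T)"
    by (simp add: power2_eq_square algebra_simps flip: exp_add)
  finally have 2: "real N * a\<^sup>2 \<le> 4/81 * ?x" using smaller[OF g] by simp
  have "2 * sqrt (real N) * a * exp (g * T) = 4/9 * (exp (- (2 * \<gamma> + g) * T) * exp (g * T))"
    using N by (simp add: a)
  also have "exp (- (2 * \<gamma> + g) * T) * exp (g * T) = ?x"
    by (simp add: algebra_simps flip: exp_add)
  finally have 3: "2 * sqrt (real N) * a * exp (g * T) = 4/9 * ?x" .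
  have "0 < ?x" by simp
  then show ?thesis using 1 2 3 by linarith
qed


section \<open>Finite-rank feedback\<close>

text \<open>The hypothesis \<open>bounded\<close> makes the supremum in \<open>op_norm_on\<close> meaningful; an unbounded family has an
  unspecified supremum in the reals.\<close>

lemma norm_le_op_norm_on:
  assumes X: "subspace X" and F: "\<And>c v. F (c *\<^sub>R v) = c *\<^sub>R F v"
    and bounded: "\<And>v. v \<in> X \<Longrightarrow> norm (F v) \<le> K * norm v"
  shows "v \<in> X \<Longrightarrow> norm (F v) \<le> op_norm_on X F * norm v" and "0 \<le> op_norm_on X F"
proof -
  have "norm (F v) \<le> \<bar>K\<bar>" if "v \<in> X" "norm v \<le> 1" for v
  proof -
    have "norm (F v) \<le> \<bar>K\<bar> * norm v"
      using bounded[OF that(1)] mult_right_mono[of K "\<bar>K\<bar>" "norm v"] by fastforce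
    then show ?thesis using mult_left_mono[OF that(2), of "\<bar>K\<bar>"] by simp
  qed
  then have bdd: "bdd_above ((\<lambda>v. norm (F v)) ` {v \<in> X. norm v \<le> 1})"
    by (intro bdd_aboveI2) auto
  have upper: "norm (F v) \<le> op_norm_on X F" if "v \<in> X" "norm v \<le> 1" for v
    unfolding op_norm_on_def by (rule cSUP_upper[OF _ bdd]) (use that in simp)
  show "0 \<le> op_norm_on X F"
    using upper[of 0] subspace_0[OF X] by (auto intro: order_trans[OF norm_ge_zero])
  assume v: "v \<in> X"
  show "norm (F v) \<le> op_norm_on X F * norm v"
  proof (cases "v = 0")
    case True
    then show ?thesis using F[of 0 0] by simp
  next
    case False
    have "norm (F v) / norm v = norm (F ((1 / norm v) *\<^sub>R v))" by (simp add: F)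
    also have "\<dots> \<le> op_norm_on X F"
      by (rule upper) (use v False subspace_scale[OF X] in auto)
    finally show ?thesis using False by (simp add: field_simps)
  qed
qed

lemma norm_feedback_le: "norm (feedback N f h v) \<le> (\<Sum>j=1..N. norm (h j) * norm (f j)) * norm v"
proof -
  have "norm (\<Sum>j=1..N. (v \<bullet> h j) *\<^sub>R f j) \<le> (\<Sum>j=1..N. norm (h j) * norm (f j) * norm v)"
  proof (rule sum_norm_le)
    fix j
    have "\<bar>v \<bullet> h j\<bar> * norm (f j) \<le> norm v * norm (h j) * norm (f j)"
      by (intro mult_right_mono Cauchy_Schwarz_ineq2) simp
    then show "norm ((v \<bullet> h j) *\<^sub>R f j) \<le> norm (h j) * norm (f j) * norm v"
      by (simp add: mult_ac)
  qed
  then show ?thesis by (simp add: feedback_def sum_distrib_right)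
qed

lemma feedback_scaleR: "feedback N f h (c *\<^sub>R v) = c *\<^sub>R feedback N f h v"
  by (simp add: feedback_def scaleR_sum_right)


section \<open>The closed-loop forcing\<close>

lemma pulse_index_unique:
  fixes T :: real
  assumes T: "0 < T" and i: "2 * real i * T \<le> s" "s < 2 * real i * T + 2 * T"
    and k: "s \<in> {(2 * real k + 1) * T ..< (2 * real k + 3/2) * T}"
  shows "k = i"
proof -
  have "(2 * real i) * T < (2 * real k + 2) * T"
    using i k T by (simp add: algebra_simps)
  then have "2 * real i < 2 * real k + 2" using T by (simp only: mult_less_cancel_right_pos)
  moreover have "(2 * real k + 1) * T < (2 * real i + 2) * T"
    using i k by (simp add: algebra_simps)
  then have "2 * real k + 1 < 2 * real i + 2" using T by (simp only: mult_less_cancel_right_pos)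
  ultimately show ?thesis by linarith
qed

lemma closed_loop_forcing_on_period:
  assumes T: "0 < T" and s: "2 * real i * T \<le> s" "s < 2 * real i * T + 2 * T"
  shows "closed_loop_forcing \<omega>1 F T y s
    = indicator {(2 * real i + 1) * T ..< (2 * real i + 3/2) * T} s
        *\<^sub>R F (restr \<omega>1 (y ((2 * real i + 3/4) * T)))"
proof -
  define f where "f k = indicator {(2 * real k + 1) * T ..< (2 * real k + 3/2) * T} s
      *\<^sub>R F (restr \<omega>1 (y ((2 * real k + 3/4) * T)))" for k
  have "f k = 0" if "k \<notin> {i}" for k
    using pulse_index_unique[OF T s, of k] that by (auto simp: f_def indicator_def)
  then have "suminf f = f i" using suminf_finite[of "{i}" f] by simp
  then show ?thesis by (simp only: closed_loop_forcing_def f_def[abs_def])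
qed

lemma closed_loop_forcing_in:
  assumes T: "0 < T" and X: "subspace X" and F: "\<And>v. F v \<in> X"
  shows "closed_loop_forcing \<omega>1 F T y s \<in> X"
proof (cases "\<exists>k. s \<in> {(2 * real k + 1) * T ..< (2 * real k + 3/2) * T}")
  case True
  then obtain k where k: "s \<in> {(2 * real k + 1) * T ..< (2 * real k + 3/2) * T}" by blast
  then have "2 * real k * T \<le> s" "s < 2 * real k * T + 2 * T"
    using T by (auto simp: algebra_simps)
  then show ?thesis
    by (simp add: closed_loop_forcing_on_period[OF T] subspace_scale[OF X] F)
next
  case False
  then show ?thesis
    using subspace_0[OF X] by (simp add: closed_loop_forcing_def)
qed


section \<open>Dual families from the spectral inequality\<close>

text \<open>The restrictions of \<open>\<xi> 1, \<dots>, \<xi> M\<close> to \<open>E\<close> have Gram matrix \<open>gram E \<xi>\<close>; the columns of its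
  inverse are the coefficients of the dual basis of their span.\<close>

lemma dual_element:
  assumes E: "E \<in> sets lebesgue" and inv: "inverse_matrix M (gram E \<xi>) C" and j: "j \<in> {1..M}"
  shows "\<exists>p\<in>L2_on E. (\<forall>i\<in>{1..M}. p \<bullet> \<xi> i = (if i = j then 1 else 0)) \<and> (norm p)\<^sup>2 = C j j"
proof -
  define p where "p = (\<Sum>k=1..M. C k j *\<^sub>R restr E (\<xi> k))"
  have p_in: "p \<in> L2_on E"
    unfolding p_def
    by (intro subspace_sum subspace_scale subspace_L2_on E restr_in_L2_on)
  have sym: "gram E \<xi> i k = gram E \<xi> k i" for i k
    unfolding gram_def by (simp add: mult.commute)
  have dual: "p \<bullet> \<xi> i = (if i = j then 1 else 0)" if i: "i \<in> {1..M}" for i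
  proof -
    have gram: "gram E \<xi> i k = restr E (\<xi> k) \<bullet> \<xi> i" for k
      by (subst sym) (rule gram_eq_inner_restr[OF E])
    have "p \<bullet> \<xi> i = (\<Sum>k=1..M. gram E \<xi> i k * C k j)"
      unfolding p_def inner_sum_left
      by (rule sum.cong) (simp_all add: gram)
    then show ?thesis using inv i j by (simp add: inverse_matrix_def)
  qed
  have "(norm p)\<^sup>2 = p \<bullet> (\<Sum>k=1..M. C k j *\<^sub>R restr E (\<xi> k))"
    by (simp only: power2_norm_eq_inner flip: p_def)
  also have "\<dots> = (\<Sum>k=1..M. C k j * (restr E p \<bullet> \<xi> k))"
    by (simp add: inner_sum_right inner_restr_left[OF E])
  also have "restr E p = p" using p_in L2_on_iff_restr[OF E] by blast
  also have "(\<Sum>k=1..M. C k j * (p \<bullet> \<xi> k)) = (\<Sum>k=1..M. if k = j then C k j else 0)"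
    by (rule sum.cong) (use dual in auto)
  also have "\<dots> = C j j" using j by simp
  finally show ?thesis using p_in dual by blast
qed

lemma quadratic_form_unit:
  fixes C :: "nat \<Rightarrow> nat \<Rightarrow> real"
  assumes j: "j \<in> {1..M}"
    and le: "\<And>\<alpha>. (\<Sum>i=1..M. \<Sum>k=1..M. \<alpha> i * C i k * \<alpha> k) \<le> K * (\<Sum>i=1..M. (\<alpha> i)\<^sup>2)"
  shows "C j j \<le> K"
proof -
  let ?\<alpha> = "\<lambda>i. if i = j then 1 else (0::real)"
  have "(\<Sum>i=1..M. \<Sum>k=1..M. ?\<alpha> i * C i k * ?\<alpha> k) = (\<Sum>i=1..M. if i = j then C i j else 0)"
  proof (rule sum.cong[OF refl])
    fix i
    have "(\<Sum>k=1..M. ?\<alpha> i * C i k * ?\<alpha> k) = (\<Sum>k=1..M. if k = j then ?\<alpha> i * C i k else 0)"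
      by (rule sum.cong) auto
    then show "(\<Sum>k=1..M. ?\<alpha> i * C i k * ?\<alpha> k) = (if i = j then C i j else 0)"
      using j by simp
  qed
  moreover have "(\<Sum>i=1..M. (?\<alpha> i)\<^sup>2) = (\<Sum>i=1..M. if i = j then 1 else 0)"
    by (rule sum.cong) auto
  ultimately show ?thesis using le[of ?\<alpha>] j by simp
qed


section \<open>The minimal-norm controls\<close>

text \<open>The trajectory is determined by the control, so that the admissible controls are described by the
  end state alone.\<close>

lemma distributed_controls_iff:
  assumes diag: "diagonal_semigroup (L2_on \<Omega>) P S lam \<xi> g" and T: "0 < T" and j: "1 \<le> j"
    and sub: "L2_on \<omega> \<subseteq> L2_on \<Omega>"
  shows "q \<in> distributed_controls S \<omega> (span (\<xi> ` {1..M})) \<epsilon> T (\<xi> j) \<longleftrightarrow> q \<in> L2_on \<omega> \<and>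
    norm (diagonal_semigroup.proj \<xi> M (S (T/2) (\<xi> j) + diagonal_semigroup.response S (T/2) q)) \<le> \<epsilon>"
proof -
  interpret diagonal_semigroup "L2_on \<Omega>" P S lam \<xi> g by (rule diag)
  have sol: "mild_solution S {0..T/2} (\<xi> j) (\<lambda>s. q) (\<lambda>t. S t (\<xi> j) + response t q)" if "q \<in> L2_on \<omega>"
    using that sub has_integral_response by (auto simp: mild_solution_def)
  have unique: "y (T/2) = S (T/2) (\<xi> j) + response (T/2) q"
    if "mild_solution S {0..T/2} (\<xi> j) (\<lambda>s. q) y" "q \<in> L2_on \<omega>" for y
  proof -
    have "((\<lambda>s. S (T/2 - s) q) has_integral y (T/2) - S (T/2) (\<xi> j)) {0..T/2}"
      using that(1) T by (auto simp: mild_solution_def)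
    moreover have "((\<lambda>s. S (T/2 - s) q) has_integral response (T/2) q) {0..T/2}"
      using has_integral_response that(2) sub by blast
    ultimately have "y (T/2) - S (T/2) (\<xi> j) = response (T/2) q" by (rule has_integral_unique)
    then show ?thesis by (simp add: algebra_simps)
  qed
  show ?thesis
    unfolding distributed_controls_def orth_proj_span norm_xi[OF j] mult_1_right mem_Collect_eq
    using sol unique by metis
qed

text \<open>Here the state before the impulse has to be identified with the left limit at \<open>T / 4\<close>, which is
  where continuity of the semigroup enters.\<close>

lemma impulse_controls_iff:
  assumes diag: "diagonal_semigroup (L2_on \<Omega>) P S lam \<xi> g" and T: "0 < T" and j: "1 \<le> j"
    and sub: "L2_on \<omega>1 \<subseteq> L2_on \<Omega>"
  shows "q \<in> impulse_controls S \<omega>1 (span (\<xi> ` {1..M})) \<epsilon> T (\<xi> j) \<longleftrightarrow> q \<in> L2_on \<omega>1 \<and>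
    norm (diagonal_semigroup.proj \<xi> M (S (T/2) (\<xi> j) + S (T/4) q)) \<le> \<epsilon>"
proof -
  interpret diagonal_semigroup "L2_on \<Omega>" P S lam \<xi> g by (rule diag)
  have limit: "((\<lambda>t. S t (\<xi> j)) \<longlongrightarrow> S (T/4) (\<xi> j)) (at_left (T/4))"
  proof -
    have "continuous_on {0..} (\<lambda>t. S t (\<xi> j))" by (rule continuous_on_S[OF xi_in[OF j]])
    then have "((\<lambda>t. S t (\<xi> j)) \<longlongrightarrow> S (T/4) (\<xi> j)) (at (T/4) within {0..})"
      using T by (simp add: continuous_on_def)
    then have "((\<lambda>t. S t (\<xi> j)) \<longlongrightarrow> S (T/4) (\<xi> j)) (at (T/4))"
      using T by (simp add: at_within_interior[of "T/4" "{0..}"])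
    then show ?thesis by (rule tendsto_mono[rotated]) (simp add: at_le)
  qed
  have left: "\<forall>\<^sub>F t in at_left (T/4). z t = S t (\<xi> j)" if "\<forall>t\<in>{0..<T/4}. z t = S t (\<xi> j)" for z
    unfolding eventually_at_left_field using that T by (auto intro!: exI[of _ 0])
  have split: "S (T/4) (S (T/4) (\<xi> j) + q) = S (T/2) (\<xi> j) + S (T/4) q" if "q \<in> L2_on \<omega>1"
    using that sub T S_add[of "T/4" "S (T/4) (\<xi> j)" q] S_comp[of "T/4" "T/4" "\<xi> j"] xi_in[OF j]
    by (auto simp: S_in)
  have sol: "\<exists>z. impulse_solution S (T/4) (T/2) (\<xi> j) q z \<and> z (T/2) = S (T/2) (\<xi> j) + S (T/4) q"
    if q: "q \<in> L2_on \<omega>1"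
  proof (intro exI conjI)
    let ?z = "\<lambda>t. if t < T/4 then S t (\<xi> j) else S (t - T/4) (S (T/4) (\<xi> j) + q)"
    have "?z (T/4) = S (T/4) (\<xi> j) + q"
      using q sub T xi_in[OF j] by (auto intro!: S_zero subspace_add[OF subspace_X] S_in)
    moreover have "(?z \<longlongrightarrow> S (T/4) (\<xi> j)) (at_left (T/4))"
      by (rule Lim_transform_eventually[OF limit])
         (rule eventually_mono[OF left[of ?z]], auto)
    moreover have "\<forall>t\<in>{0..<T/4}. ?z t = S t (\<xi> j)" by simp
    moreover from calculation(1) have "\<forall>t\<in>{T/4..T/2}. ?z t = S (t - T/4) (?z (T/4))"
      by (simp only:) simp
    ultimately show "impulse_solution S (T/4) (T/2) (\<xi> j) q ?z"
      unfolding impulse_solution_def by blast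
    show "?z (T/2) = S (T/2) (\<xi> j) + S (T/4) q"
      using split[OF q] T by simp
  qed
  have unique: "z (T/2) = S (T/2) (\<xi> j) + S (T/4) q"
    if z: "impulse_solution S (T/4) (T/2) (\<xi> j) q z" and q: "q \<in> L2_on \<omega>1" for z
  proof -
    have before: "\<forall>t\<in>{0..<T/4}. z t = S t (\<xi> j)"
      and after: "\<forall>t\<in>{T/4..T/2}. z t = S (t - T/4) (z (T/4))"
      and jump: "\<exists>l. (z \<longlongrightarrow> l) (at_left (T/4)) \<and> z (T/4) = l + q"
      using z unfolding impulse_solution_def by blast+
    from jump obtain l where l: "(z \<longlongrightarrow> l) (at_left (T/4))" "z (T/4) = l + q" by blast
    have "(z \<longlongrightarrow> S (T/4) (\<xi> j)) (at_left (T/4))"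
      by (rule Lim_transform_eventually[OF limit], rule eventually_mono[OF left[OF before]]) simp
    then have "l = S (T/4) (\<xi> j)"
      by (rule tendsto_unique[OF trivial_limit_at_left_real l(1)])
    moreover have "z (T/2) = S (T/2 - T/4) (z (T/4))"
      by (rule bspec[OF after]) (use T in auto)
    ultimately show ?thesis using l(2) split[OF q] by simp
  qed
  show ?thesis
    unfolding impulse_controls_def orth_proj_span norm_xi[OF j] mult_1_right mem_Collect_eq
    using sol unique by metis
qed


theorem theorem4p1:
  fixes \<Omega> \<omega> \<omega>1 :: "'a::euclidean_space set"
    and V :: "'a \<Rightarrow> real"
    and S :: "real \<Rightarrow> 'a L2 \<Rightarrow> 'a L2"
    and lam :: "nat \<Rightarrow> real" and \<xi> f h :: "nat \<Rightarrow> 'a L2"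
    and m N M :: nat
    and C0 T \<gamma> \<gamma>0 cp \<epsilon>0 :: real
    and F :: "'a L2 \<Rightarrow> 'a L2"
    and y :: "real \<Rightarrow> 'a L2"
  assumes "bounded_C2_domain \<Omega>"
    and "V \<in> Linf_on \<Omega>" and "\<not> (AE x in lebesgue_on \<Omega>. V x = 0)"
    and "\<gamma>0 = Linf_norm \<Omega> V"
    and "open \<omega>" "\<omega> \<noteq> {}" "\<omega> \<subseteq> \<Omega>"
    and "open \<omega>1" "\<omega>1 \<noteq> {}" "\<omega>1 \<subseteq> \<Omega>"
    and "C0_semigroup_on (L2_on \<Omega>) S"
    and "generator_on (L2_on \<Omega>) S = schroedinger_op \<Omega> V"
    and "spectral_data \<Omega> V lam \<xi> m"
    and "spectral_constant \<Omega> \<omega> \<omega>1 C0"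
    and "T > 0" and "\<gamma> > 0"
    and "cp = max 0 (lam (Suc m) - 3 * \<gamma>0)"
    and "is_greatest {j. 1 \<le> j \<and> lam j < 2 * \<gamma> + ln 9 / T} N"
    and "is_greatest {j. 1 \<le> j \<and> lam j < threshold (C0 / 2) \<gamma>0 cp N \<gamma> T} M"
    and "\<epsilon>0 = tolerance \<gamma>0 cp N \<gamma> T"
    and "\<forall>j\<in>{1..N}. is_arg_min norm
           (\<lambda>g. g \<in> distributed_controls S \<omega> (span (\<xi> ` {1..M})) \<epsilon>0 T (\<xi> j)) (f j)"
    and "\<forall>j\<in>{1..N}. is_arg_min norm
           (\<lambda>g. g \<in> impulse_controls S \<omega>1 (span (\<xi> ` {1..M})) \<epsilon>0 T (\<xi> j)) (h j)"
    and "F = feedback N f h"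
    and "y 0 \<in> L2_on \<Omega>"
    and "mild_solution S {0..} (y 0) (closed_loop_forcing \<omega>1 F T y) y"
  shows "\<forall>t>0. norm (y t) \<le>
           (1 + T / 2 * op_norm_on (L2_on \<omega>1) F) * exp ((2 * \<gamma>0 + 3 * \<gamma>) * T) * exp (- \<gamma> * t) * norm (y 0)"
proof (intro allI impI)
  fix t :: real assume t: "t > 0"
  note V = assms(2) and T = \<open>T > 0\<close> and \<gamma> = \<open>\<gamma> > 0\<close>
  have sets: "\<Omega> \<in> sets lebesgue" "\<omega> \<in> sets lebesgue" "\<omega>1 \<in> sets lebesgue"
    using assms(1,5,8) by (auto simp: bounded_C2_domain_def)
  have sub: "L2_on \<omega> \<subseteq> L2_on \<Omega>" "L2_on \<omega>1 \<subseteq> L2_on \<Omega>"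
    using assms(7,10) by (simp_all add: L2_on_mono)
  have eig: "\<And>j. 1 \<le> j \<Longrightarrow> (\<xi> j, - lam j *\<^sub>R \<xi> j) \<in> schroedinger_op \<Omega> V"
    and orth: "\<And>i j. 1 \<le> i \<Longrightarrow> 1 \<le> j \<Longrightarrow> \<xi> i \<bullet> \<xi> j = (if i = j then 1 else 0)"
    and dense: "closure (span (\<xi> ` {1..})) = L2_on \<Omega>"
    and mono: "\<And>i j. 1 \<le> i \<Longrightarrow> i \<le> j \<Longrightarrow> lam i \<le> lam j"
    and negative: "\<exists>j\<ge>1. lam j < 0" and m: "1 \<le> m" "0 < lam (Suc m)"
    using assms(13) unfolding spectral_data_def by auto
  have lower: "- max 0 \<gamma>0 \<le> lam j" if "1 \<le> j" for j
    unfolding assms(4) using that orth[of j j]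
    by (intro eigenvalue_lower_bound[OF sets(1) V eig]) (auto simp: norm_eq_1)
  have \<gamma>0: "0 < \<gamma>0" using negative lower by fastforce
  have closed: "closed (L2_on \<Omega>)" unfolding dense[symmetric] by (rule closed_closure)
  interpret diagonal_semigroup "L2_on \<Omega>" "restr \<Omega>" S lam \<xi> \<gamma>0
  proof (rule diagonal_semigroup.intro)
    show "bounded_linear (restr \<Omega>)" by (rule bounded_linear_restr[OF sets(1)])
    show "restr \<Omega> u \<in> L2_on \<Omega>" for u by (rule restr_in_L2_on[OF sets(1)])
    show "restr \<Omega> u = u" if "u \<in> L2_on \<Omega>" for u using that L2_on_iff_restr[OF sets(1)] by blast
    show "S t (\<xi> j) = exp (- lam j * t) *\<^sub>R \<xi> j" if "1 \<le> j" "0 \<le> t" for j t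
      using eig[OF that(1)] assms(12)
      by (intro semigroup_eigenvector[OF closed subspace_L2_on[OF sets(1)] assms(11) _ that(2)]) simp
    show "- \<gamma>0 \<le> lam j" if "1 \<le> j" for j using lower[OF that] \<gamma>0 by simp
  qed (use assms(11) orth dense \<gamma>0 in auto)
  note diag = diagonal_semigroup_axioms

  define C where "C = threshold (C0 / 2) \<gamma>0 cp N \<gamma> T"
  have C0: "C0 > 0" using assms(14) by (simp add: spectral_constant_def)
  have cp: "0 \<le> cp" "lam (Suc m) - 3 * \<gamma>0 \<le> cp" using assms(17) by auto
  have N: "1 \<le> N" "lam N < 2 * \<gamma> + ln 9 / T"
    and N_max: "\<And>j. 1 \<le> j \<Longrightarrow> lam j < 2 * \<gamma> + ln 9 / T \<Longrightarrow> j \<le> N"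
    using assms(18) by (auto simp: is_greatest_def)
  have M: "1 \<le> M" "lam M < C" and M_max: "\<And>j. 1 \<le> j \<Longrightarrow> lam j < C \<Longrightarrow> j \<le> M"
    using assms(19) by (auto simp: is_greatest_def C_def)
  have C_ge: "4 * \<gamma> + 3 * \<gamma>0 + 2 * ln 9 / T + cp \<le> C"
    unfolding C_def by (rule threshold_ge) (use T C0 \<gamma>0 \<gamma> N in auto)
  have ln9: "0 < ln 9 / T" "2 * ln 9 / T = 2 * (ln 9 / T)" using T by auto
  have "lam N < C" using C_ge N(2) \<gamma> \<gamma>0 cp ln9 by linarith
  then have N_le_M: "N \<le> M" using M_max N(1) by blast
  have "lam (Suc m) < C" using C_ge \<gamma> cp ln9 by linarith
  then have "Suc m \<le> M" using M_max by simp
  then have lam_M: "0 \<le> lam M" using mono[of "Suc m" M] m by simp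
  have C_nonneg: "0 \<le> C" using M(2) lam_M by simp
  have high_N: "2 * \<gamma> + ln 9 / T \<le> lam j" if "N < j" for j
    using N_max[of j] N(1) that by (meson leD le_less_trans less_imp_le not_le order_trans)
  have high_M: "C \<le> lam j" if "M < j" for j
    using M_max[of j] M(1) that by (meson leD le_less_trans less_imp_le not_le order_trans)

  \<comment> \<open>The spectral inequality bounds squared norms, hence \<open>C0 / 2\<close>.\<close>
  define D where "D = exp (C0 / 2 * (1 + \<gamma>0 powr (2/3) + sqrt (lam M)))"
  have dual: "\<exists>p\<in>L2_on E. (\<forall>i\<in>{1..M}. p \<bullet> \<xi> i = (if i = j then 1 else 0)) \<and> norm p \<le> D"
    if E: "E \<in> {\<omega>, \<omega>1}" and j: "j \<in> {1..M}" for E j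
  proof -
    have "\<exists>B. inverse_matrix M (gram E \<xi>) B \<and> (\<forall>\<alpha>::nat \<Rightarrow> real.
        (\<Sum>i=1..M. \<Sum>j=1..M. \<alpha> i * B i j * \<alpha> j)
          \<le> exp (C0 * (1 + Linf_norm \<Omega> V powr (2/3) + sqrt (lam M))) * (\<Sum>i=1..M. (\<alpha> i)\<^sup>2))"
      using assms(2,3,13,14) E M(1) lam_M unfolding spectral_constant_def by blast
    then obtain B where B: "inverse_matrix M (gram E \<xi>) B"
      and form: "\<And>\<alpha>::nat \<Rightarrow> real. (\<Sum>i=1..M. \<Sum>j=1..M. \<alpha> i * B i j * \<alpha> j)
          \<le> exp (C0 * (1 + \<gamma>0 powr (2/3) + sqrt (lam M))) * (\<Sum>i=1..M. (\<alpha> i)\<^sup>2)"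
      unfolding assms(4) by blast
    obtain p where p: "p \<in> L2_on E" "\<forall>i\<in>{1..M}. p \<bullet> \<xi> i = (if i = j then 1 else 0)"
      and norm_p: "(norm p)\<^sup>2 = B j j"
      using dual_element[OF _ B j] E sets by blast
    have "(norm p)\<^sup>2 \<le> exp (C0 * (1 + \<gamma>0 powr (2/3) + sqrt (lam M)))"
      unfolding norm_p by (rule quadratic_form_unit[OF j form])
    also have "\<dots> = D\<^sup>2"
      by (simp add: D_def power2_eq_square flip: exp_add)
    finally have "norm p \<le> D" by (rule power2_le_imp_le) (simp add: D_def)
    then show ?thesis using p by blast
  qed

  \<comment> \<open>The common bound for the states reached from \<open>\<xi> j\<close> at time \<open>T\<close> by \<open>f j\<close> and by \<open>h j\<close>.\<close>
  define a where "a = 2 / (9 * sqrt (real N)) * exp (- (2 * \<gamma> + \<gamma>0) * T)"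
  have budget: "exp (\<gamma>0 * T / 2) * \<epsilon>0 + exp (- C * T / 2) * (exp (\<gamma>0 * T / 4) * D) \<le> a"
    unfolding a_def C_def D_def assms(20)
    by (rule steering_budget) (use T C0 \<gamma>0 \<gamma> N cp M(2) in \<open>auto simp: C_def\<close>)
  have \<epsilon>0: "0 \<le> \<epsilon>0" by (simp add: assms(20) tolerance_def)

  have f: "f j \<in> L2_on \<Omega>"
      "norm (S (T/2) (S (T/2) (\<xi> j) + response (T/2) (f j))) \<le> a" if j: "j \<in> {1..N}" for j
  proof -
    have j': "1 \<le> j" "j \<le> M" using j N_le_M by auto
    note iff = distributed_controls_iff[OF diag T j'(1) sub(1), of _ M \<epsilon>0]
    have fj: "f j \<in> L2_on \<omega>" "norm (proj M (S (T/2) (\<xi> j) + response (T/2) (f j))) \<le> \<epsilon>0"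
      and minimal: "\<And>q. q \<in> distributed_controls S \<omega> (span (\<xi> ` {1..M})) \<epsilon>0 T (\<xi> j) \<Longrightarrow> norm (f j) \<le> norm q"
      using assms(21) j iff[of "f j"] unfolding is_arg_min_def by (auto simp: not_less)
    show fX: "f j \<in> L2_on \<Omega>" using fj(1) sub by blast
    obtain p where p: "p \<in> L2_on \<omega>" "\<forall>i\<in>{1..M}. p \<bullet> \<xi> i = (if i = j then 1 else 0)" "norm p \<le> D"
      using dual[of \<omega> j] j' by auto
    have pX: "p \<in> L2_on \<Omega>" using p(1) sub by blast
    obtain c where c: "\<bar>c\<bar> \<le> 2 / T * exp (\<gamma>0 * T / 4)"
        "proj M (S (T/2) (\<xi> j) + response (T/2) (c *\<^sub>R p)) = 0"
      using distributed_steering[OF T j' pX] p(2) by auto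
    have "c *\<^sub>R p \<in> distributed_controls S \<omega> (span (\<xi> ` {1..M})) \<epsilon>0 T (\<xi> j)"
      unfolding iff using c(2) \<epsilon>0 p(1) subspace_scale[OF subspace_L2_on[OF sets(2)]] by simp
    then have "norm (f j) \<le> \<bar>c\<bar> * norm p" using minimal by fastforce
    also have "\<dots> \<le> (2 / T * exp (\<gamma>0 * T / 4)) * D"
      using c(1) p(3) T by (intro mult_mono) auto
    finally have "T/2 * norm (f j) \<le> T/2 * ((2 / T * exp (\<gamma>0 * T / 4)) * D)"
      using T by (intro mult_left_mono) auto
    then have "T/2 * norm (f j) \<le> exp (\<gamma>0 * T / 4) * D" using T by simp
    moreover have "norm (response (T/2) (f j) - proj M (response (T/2) (f j))) \<le> T/2 * norm (f j)"
      by (rule norm_response_diff_proj) (use T fX high_M C_nonneg in \<open>auto intro: order_trans\<close>)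
    ultimately have "norm (response (T/2) (f j) - proj M (response (T/2) (f j))) \<le> exp (\<gamma>0 * T / 4) * D"
      by linarith
    from norm_steered_le[OF T j' response_in[OF fX] fj(2) this high_M] budget
    show "norm (S (T/2) (S (T/2) (\<xi> j) + response (T/2) (f j))) \<le> a" by linarith
  qed

  have h: "h j \<in> L2_on \<omega>1" "h j \<in> L2_on \<Omega>"
      "norm (S (T/2) (S (T/2) (\<xi> j) + S (T/4) (h j))) \<le> a" if j: "j \<in> {1..N}" for j
  proof -
    have j': "1 \<le> j" "j \<le> M" using j N_le_M by auto
    note iff = impulse_controls_iff[OF diag T j'(1) sub(2), of _ M \<epsilon>0]
    have hj: "h j \<in> L2_on \<omega>1" "norm (proj M (S (T/2) (\<xi> j) + S (T/4) (h j))) \<le> \<epsilon>0"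
      and minimal: "\<And>q. q \<in> impulse_controls S \<omega>1 (span (\<xi> ` {1..M})) \<epsilon>0 T (\<xi> j) \<Longrightarrow> norm (h j) \<le> norm q"
      using assms(22) j iff[of "h j"] unfolding is_arg_min_def by (auto simp: not_less)
    show "h j \<in> L2_on \<omega>1" by (rule hj(1))
    show hX: "h j \<in> L2_on \<Omega>" using hj(1) sub by blast
    obtain p where p: "p \<in> L2_on \<omega>1" "\<forall>i\<in>{1..M}. p \<bullet> \<xi> i = (if i = j then 1 else 0)" "norm p \<le> D"
      using dual[of \<omega>1 j] j' by auto
    have pX: "p \<in> L2_on \<Omega>" using p(1) sub by blast
    obtain c where c: "\<bar>c\<bar> \<le> exp (\<gamma>0 * T / 4)"
        "proj M (S (T/2) (\<xi> j) + S (T/4) (c *\<^sub>R p)) = 0"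
      using impulse_steering[OF T j' pX] p(2) by auto
    have "c *\<^sub>R p \<in> impulse_controls S \<omega>1 (span (\<xi> ` {1..M})) \<epsilon>0 T (\<xi> j)"
      unfolding iff using c(2) \<epsilon>0 p(1) subspace_scale[OF subspace_L2_on[OF sets(3)]] by simp
    then have "norm (h j) \<le> \<bar>c\<bar> * norm p" using minimal by fastforce
    also have "\<dots> \<le> exp (\<gamma>0 * T / 4) * D"
      using c(1) p(3) by (intro mult_mono) auto
    finally have "norm (h j) \<le> exp (\<gamma>0 * T / 4) * D" .
    moreover have "norm (S (T/4) (h j) - proj M (S (T/4) (h j))) \<le> norm (h j)"
      by (rule norm_S_diff_proj_le_norm) (use T hX high_M C_nonneg in \<open>auto intro: order_trans\<close>)
    ultimately have "norm (S (T/4) (h j) - proj M (S (T/4) (h j))) \<le> exp (\<gamma>0 * T / 4) * D"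
      by linarith
    from norm_steered_le[OF T j' _ hj(2) this high_M] budget S_in[OF _ hX, of "T/4"] T
    show "norm (S (T/2) (S (T/2) (\<xi> j) + S (T/4) (h j))) \<le> a" by fastforce
  qed

  note F = \<open>F = feedback N f h\<close>
  have F_in: "F v \<in> L2_on \<Omega>" for v
    unfolding F feedback_def
    by (intro subspace_neg[OF subspace_X] subspace_sum[OF subspace_X] subspace_scale[OF subspace_X] f)
  have F_restr: "F (restr \<omega>1 v) = F v" for v
  proof -
    have "restr \<omega>1 v \<bullet> h j = v \<bullet> h j" if "j \<in> {1..N}" for j
      using h(1)[OF that] by (simp add: inner_restr_left[OF sets(3)] L2_on_iff_restr[OF sets(3)])
    then have "(\<Sum>j=1..N. (restr \<omega>1 v \<bullet> h j) *\<^sub>R f j) = (\<Sum>j=1..N. (v \<bullet> h j) *\<^sub>R f j)"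
      by (intro sum.cong) auto
    then show ?thesis unfolding F feedback_def by simp
  qed
  define \<Phi> where "\<Phi> = op_norm_on (L2_on \<omega>1) F"
  note op = norm_le_op_norm_on[OF subspace_L2_on[OF sets(3)], of F, folded \<Phi>_def,
      OF feedback_scaleR[of N f h, folded F] norm_feedback_le[of N f h, folded F]]
  have \<Phi>: "0 \<le> \<Phi>" by (rule op(2))
  have F_le: "norm (F (restr \<omega>1 v)) \<le> \<Phi> * norm v" for v
    using op(1)[OF restr_in_L2_on[OF sets(3)], of v] norm_restr_le[OF sets(3), of v]
      mult_left_mono[OF _ \<Phi>] by (meson order_trans)
  have contraction: "norm (S (2*T) v + S (T/2) (response (T/2) (F (restr \<omega>1 (S (3*T/4) v)))))
      \<le> exp (- 2 * \<gamma> * T) * norm v" if v: "v \<in> L2_on \<Omega>" for v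
  proof -
    have "norm (S (2*T) v + S (T/2) (response (T/2) (feedback N f h (S (3*T/4) v))))
      \<le> (exp (- 2 * (2 * \<gamma> + ln 9 / T) * T) + real N * a\<^sup>2 + 2 * sqrt (real N) * a * exp (\<gamma>0 * T)) * norm v"
      by (rule period_contraction[OF T v]) (use f h high_N in \<open>auto simp: a_def\<close>)
    also have "\<dots> \<le> exp (- 2 * \<gamma> * T) * norm v"
      by (intro mult_right_mono contraction_factor_le[OF T _ _ N(1) a_def]) (use \<gamma> \<gamma>0 in auto)
    finally show ?thesis unfolding F_restr unfolding F .
  qed
  have "norm (y t) \<le> (1 + T/2 * \<Phi>) * exp ((2 * \<gamma>0 + 2 * \<gamma>) * T) * exp (- \<gamma> * t) * norm (y 0)"
  proof (rule closed_loop_decay[where G = "\<lambda>v. F (restr \<omega>1 v)"])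
    show "mild_solution S {0..} (y 0) (closed_loop_forcing \<omega>1 F T y) y" by (rule assms(25))
    show "closed_loop_forcing \<omega>1 F T y s \<in> L2_on \<Omega>" for s
      by (rule closed_loop_forcing_in[OF T subspace_X F_in])
  qed (use assms(24) T \<gamma> F_in F_le \<Phi> contraction closed_loop_forcing_on_period[OF T] t in auto)
  also have "\<dots> \<le> (1 + T/2 * \<Phi>) * exp ((2 * \<gamma>0 + 3 * \<gamma>) * T) * exp (- \<gamma> * t) * norm (y 0)"
    using T \<gamma> \<Phi> by (intro mult_right_mono mult_left_mono) auto
  finally show "norm (y t) \<le> (1 + T / 2 * op_norm_on (L2_on \<omega>1) F) * exp ((2 * \<gamma>0 + 3 * \<gamma>) * T)
      * exp (- \<gamma> * t) * norm (y 0)"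
    unfolding \<Phi>_def .
qed

end
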